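(* Let $(W,S)$ be a Coxeter system, let $I,J\subset S$ be finitary and let $I'=Is$ be finitary with $s\in S\setminus I$. Let $p$ be a $(J,I)$-coset and $q$ a $(J,I')$-coset with $p\subset q$. Then $[p,q]$ is reduced if and only if $p\notin H_+$ for every root hyperplane $H$ containing $q$. Similarly, $[q,p]$ is reduced if and only if $p\notin H_-$ for every root hyperplane $H$ containing $q$.
   Context: Let $(W,S)$ be a Coxeter system with identity $e$, length $\ell_W$ and Bruhat order. $W_I$ is the parabolic subgroup generated by $I\subset S$; $I$ is finitary if $W_I$ is finite. $Is=I\sqcup\{s\}$. A $(J,I)$-coset is a double coset $p\in W_J\backslash W/W_I$ ($J,I$ finitary, part of the data), with unique Bruhat-maximal element $\overline p$ and Bruhat-minimal element $\underline p$. Reducedness of one step: for a $(J,I)$-coset $p$ and a $(J,Is)$-coset $q$ with $p\subset q$, $[p,q]$ is reduced if $\underline p=\underline q$ and $J\cap\underline pI\underline p^{-1}=J\cap\underline q(Is)\underline q^{-1}$; and $[q,p]$ is reduced if $\overline p=\overline q$. Hyperplanes: consider the hyperplane arrangement of $W$ in its real reflection representation (for infinite $W$, in the Tits cone of the dual of the geometric representation), whose chambers are in bijection with $W$. For each root hyperplane $H=H_r$ (with $r$ a reflection of $W$), $H_-$ is the open half space containing the chamber of $e$ and $H_+$ is the opposite open half space. A $(\emptyset,I)$-coset $wW_I$ is identified with the facet $w\cdot F_I$, where $F_I$ is the facet of the dominant chamber with stabilizer $W_I$. A general $(J,I)$-coset $p$ is identified with the facet of the $(\emptyset,I)$-coset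 $\overline pW_I$, i.e. the $(\emptyset,I)$-coset with the same maximal element. Thus each double coset lies on $H$, in $H_-$ or in $H_+$. Concretely, $p$ lies on $H_r$ iff $r\in\overline pW_I\overline p^{-1}$; otherwise it lies in $H_{r,-}$ if $\ell_W(r\overline p)>\ell_W(\overline p)$ and in $H_{r,+}$ if $\ell_W(r\overline p)<\ell_W(\overline p)$. *)

theory Defs
  imports Complex_Main "HOL-Algebra.Coset" "HOL-Algebra.Generated_Groups"
    "HOL-Algebra.Multiplicative_Group"
begin

section \<open>Coxeter systems\<close>

definition word_prod :: "('a, 'b) monoid_scheme \<Rightarrow> 'a list \<Rightarrow> 'a" where
  "word_prod G ws = foldr (mult G) ws (one G)"

text \<open>
  The congruence on words in \<open>S\<close> generated by the relations \<open>(st)\<^sup>m = 1\<close>, with \<open>m\<close> the order of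
  \<open>st\<close> in \<open>G\<close>; there is no relation when \<open>st\<close> has infinite order, for which \<open>ord\<close> is \<open>0\<close>.
  If all elements of \<open>S\<close> are involutions, the case \<open>s = t\<close> has \<open>m = 1\<close> and gives \<open>ss = 1\<close>. So words
  modulo this congruence form the group with generators \<open>S\<close> and these relations, although
  no formal inverses are used.
\<close>

inductive coxeter_eq :: "('a, 'b) monoid_scheme \<Rightarrow> 'a set \<Rightarrow> 'a list \<Rightarrow> 'a list \<Rightarrow> bool"
  for G (structure) and S where
  refl: "us \<in> lists S \<Longrightarrow> coxeter_eq G S us us"
| sym: "coxeter_eq G S us vs \<Longrightarrow> coxeter_eq G S vs us"
| trans: "coxeter_eq G S us vs \<Longrightarrow> coxeter_eq G S vs ws \<Longrightarrow> coxeter_eq G S us ws"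
| relation: "us \<in> lists S \<Longrightarrow> vs \<in> lists S \<Longrightarrow> s \<in> S \<Longrightarrow> t \<in> S \<Longrightarrow> group.ord G (s \<otimes> t) \<noteq> 0 \<Longrightarrow>
    coxeter_eq G S (us @ concat (replicate (group.ord G (s \<otimes> t)) [s, t]) @ vs) (us @ vs)"

locale coxeter_system = group W for W (structure) +
  fixes S :: "'a set"
  assumes S_carrier: "S \<subseteq> carrier W"
    and S_involution: "s \<in> S \<Longrightarrow> ord s = 2"
    and S_generates: "generate W S = carrier W"
    and presentation: "us \<in> lists S \<Longrightarrow> vs \<in> lists S \<Longrightarrow>
      word_prod W us = word_prod W vs \<longleftrightarrow> coxeter_eq W S us vs"
begin

definition len :: "'a \<Rightarrow> nat" where
  "len w = (LEAST n. \<exists>ws \<in> lists S. length ws = n \<and> word_prod W ws = w)"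

definition reflections :: "'a set" where
  "reflections = {w \<otimes> s \<otimes> inv w | w s. w \<in> carrier W \<and> s \<in> S}"

definition bruhat_le :: "'a \<Rightarrow> 'a \<Rightarrow> bool" where
  "bruhat_le = (\<lambda>x y. x \<in> carrier W \<and> (\<exists>r \<in> reflections. y = x \<otimes> r) \<and> len x < len y)\<^sup>*\<^sup>*"

definition parabolic :: "'a set \<Rightarrow> 'a set" where
  "parabolic I = generate W I"

definition finitary :: "'a set \<Rightarrow> bool" where
  "finitary I \<longleftrightarrow> I \<subseteq> S \<and> finite (parabolic I)"

section \<open>Double cosets\<close>

definition double_cosets :: "'a set \<Rightarrow> 'a set \<Rightarrow> 'a set set" where
  "double_cosets J I = {parabolic J <#> (x <# parabolic I) | x. x \<in> carrier W}"

definition coset_max :: "'a set \<Rightarrow> 'a" where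
  "coset_max p = (THE x. x \<in> p \<and> (\<forall>y \<in> p. bruhat_le x y \<longrightarrow> y = x))"

definition coset_min :: "'a set \<Rightarrow> 'a" where
  "coset_min p = (THE x. x \<in> p \<and> (\<forall>y \<in> p. bruhat_le y x \<longrightarrow> y = x))"

text \<open>The left redundancy set \<open>J \<inter> x I x\<^sup>-\<^sup>1\<close>, with \<open>x\<close> the minimal element of \<open>p\<close>.\<close>

definition left_red :: "'a set \<Rightarrow> 'a set \<Rightarrow> 'a set \<Rightarrow> 'a set" where
  "left_red J I p = J \<inter> {coset_min p \<otimes> i \<otimes> inv (coset_min p) | i. i \<in> I}"

text \<open>
  A \<open>(J,I)\<close>-coset is a set together with the pair \<open>(J,I)\<close>, so the parabolic data are
  explicit arguments. \<open>reduced_up J I p I' q\<close> is reducedness of \<open>[p,q]\<close> for a \<open>(J,I)\<close>-coset \<open>p\<close>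
  contained in a \<open>(J,I')\<close>-coset \<open>q\<close>, and \<open>reduced_down q p\<close> is reducedness of \<open>[q,p]\<close>.
\<close>

definition reduced_up :: "'a set \<Rightarrow> 'a set \<Rightarrow> 'a set \<Rightarrow> 'a set \<Rightarrow> 'a set \<Rightarrow> bool" where
  "reduced_up J I p I' q \<longleftrightarrow> coset_min p = coset_min q \<and> left_red J I p = left_red J I' q"

definition reduced_down :: "'a set \<Rightarrow> 'a set \<Rightarrow> bool" where
  "reduced_down q p \<longleftrightarrow> coset_max p = coset_max q"

section \<open>The geometric representation and its dual\<close>

text \<open>
  The geometric representation is the space \<open>V\<close> of finitely supported functions \<open>S \<rightarrow> \<real>\<close>, extended
  by \<open>0\<close> outside \<open>S\<close>, with basis the simple roots.
\<close>

definition simple_root :: "'a \<Rightarrow> 'a \<Rightarrow> real" where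
  "simple_root s = (\<lambda>t. if t = s then 1 else 0)"

definition gram :: "'a \<Rightarrow> 'a \<Rightarrow> real" where
  "gram s t = (if ord (s \<otimes> t) = 0 then - 1 else - cos (pi / real (ord (s \<otimes> t))))"

definition form :: "('a \<Rightarrow> real) \<Rightarrow> ('a \<Rightarrow> real) \<Rightarrow> real" where
  "form u v = (\<Sum>s | u s \<noteq> 0. \<Sum>t | v t \<noteq> 0. u s * v t * gram s t)"

definition simple_reflection :: "'a \<Rightarrow> ('a \<Rightarrow> real) \<Rightarrow> 'a \<Rightarrow> real" where
  "simple_reflection s v = (\<lambda>t. v t - 2 * form (simple_root s) v * simple_root s t)"

text \<open>
  The simple reflections satisfy the Coxeter relations on \<open>V\<close>, so the action of \<open>w\<close> does not depend
  on the word chosen to represent it.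
\<close>

definition act :: "'a \<Rightarrow> ('a \<Rightarrow> real) \<Rightarrow> 'a \<Rightarrow> real" where
  "act w = foldr simple_reflection (SOME ws. ws \<in> lists S \<and> word_prod W ws = w)"

definition roots :: "('a \<Rightarrow> real) set" where
  "roots = {act w (simple_root s) | w s. w \<in> carrier W \<and> s \<in> S}"

text \<open>
  A linear functional \<open>l\<close> on \<open>V\<close> is encoded by its values \<open>l t\<close> on the simple roots; all functions
  on \<open>S\<close> occur, also for infinite \<open>S\<close>. \<open>dual_act\<close> is the contragredient action. For finite \<open>W\<close> the form
  is an inner product and identifies the dual equivariantly with \<open>V\<close>.
\<close>

definition dual_space :: "('a \<Rightarrow> real) set" where
  "dual_space = {l. \<forall>t. t \<notin> S \<longrightarrow> l t = 0}"

definition pairing :: "('a \<Rightarrow> real) \<Rightarrow> ('a \<Rightarrow> real) \<Rightarrow> real" where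
  "pairing l v = (\<Sum>t | v t \<noteq> 0. l t * v t)"

definition dual_act :: "'a \<Rightarrow> ('a \<Rightarrow> real) \<Rightarrow> 'a \<Rightarrow> real" where
  "dual_act w l = (\<lambda>t. if t \<in> S then pairing l (act (inv w) (simple_root t)) else 0)"

text \<open>The facet of the closed dominant chamber with stabilizer \<open>parabolic I\<close>, for finitary \<open>I\<close>.\<close>

definition dominant_facet :: "'a set \<Rightarrow> ('a \<Rightarrow> real) set" where
  "dominant_facet I = {l \<in> dual_space. \<forall>t \<in> S. if t \<in> I then l t = 0 else l t > 0}"

abbreviation dominant_chamber :: "('a \<Rightarrow> real) set" where
  "dominant_chamber \<equiv> dominant_facet {}"

text \<open>
  The hyperplane \<open>H\<close> of a root \<open>b\<close>, and its two open half spaces: \<open>half_minus b\<close> is the one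
  containing the dominant chamber (the chamber of the identity), \<open>half_plus b\<close> the opposite one.
  All three are the same for \<open>b\<close> and \<open>-b\<close>, hence depend on \<open>H\<close> only.
\<close>

definition hyperplane :: "('a \<Rightarrow> real) \<Rightarrow> ('a \<Rightarrow> real) set" where
  "hyperplane b = {l \<in> dual_space. pairing l b = 0}"

definition half_minus :: "('a \<Rightarrow> real) \<Rightarrow> ('a \<Rightarrow> real) set" where
  "half_minus b = {l \<in> dual_space. \<forall>c \<in> dominant_chamber. pairing l b * pairing c b > 0}"

definition half_plus :: "('a \<Rightarrow> real) \<Rightarrow> ('a \<Rightarrow> real) set" where
  "half_plus b = {l \<in> dual_space. \<forall>c \<in> dominant_chamber. pairing l b * pairing c b < 0}"

text \<open>
  The facet of a \<open>(J,I)\<close>-coset \<open>p\<close> is that of the \<open>(\<emptyset>,I)\<close>-coset with the same maximal element.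
\<close>

definition facet :: "'a set \<Rightarrow> 'a set \<Rightarrow> ('a \<Rightarrow> real) set" where
  "facet I p = dual_act (coset_max p) ` dominant_facet I"

end

end

theory Submission
  imports Defs
begin

text \<open>
  Let \<open>v\<close> and \<open>w\<close> be the maximal elements of \<open>p\<close> and \<open>q\<close>, and let \<open>I' = Is\<close>. A functional in the facet with
  stabilizer \<open>W\<^sub>I\<close> vanishes on the simple roots in \<open>I\<close> and is positive on the others, and every root is
  a combination of simple roots with coefficients of one sign. So the position of the facet
  \<open>v F\<^sub>I\<close> with respect to the hyperplane of a root \<open>b\<close> can be read off from \<open>v\<^sup>-\<^sup>1 b\<close>: the facet lies on the
  hyperplane if and only if \<open>v\<^sup>-\<^sup>1 b\<close> is supported in \<open>I\<close>, and otherwise its side is given by comparing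
  the signs of \<open>b\<close> and \<open>v\<^sup>-\<^sup>1 b\<close>. Since \<open>w\<close> lies in \<open>v W\<^sub>I\<^sub>'\<close>, the hyperplane of \<open>b\<close> contains the facet
  of \<open>q\<close> if and only if \<open>v\<^sup>-\<^sup>1 b\<close> is supported in \<open>I'\<close>. After the substitution \<open>\<gamma> = v\<^sup>-\<^sup>1 b\<close> the two
  geometric conditions say that \<open>v\<close> preserves, respectively reverses, the sign of every root \<open>\<gamma>\<close>
  supported in \<open>I'\<close> but not in \<open>I\<close>.

  Being maximal in \<open>p\<close>, the element \<open>v\<close> reverses the signs of the simple roots in \<open>I\<close>, and \<open>v\<^sup>-\<^sup>1\<close>
  those of the simple roots in \<open>J\<close>. It is maximal in \<open>q\<close> if and only if it also reverses the sign of
  the simple root of \<open>s\<close>. This settles \<open>[q,p]\<close>, because an element that reverses the signs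
  of the simple roots in \<open>I'\<close> reverses the signs of all roots supported there.

  For \<open>[p,q]\<close> let \<open>u\<close> be the shortest element of \<open>v W\<^sub>I\<close>. Elements of \<open>W\<^sub>I\<close> permute the positive roots
  supported in \<open>I'\<close> but not in \<open>I\<close>, so the condition on \<open>v\<close> becomes \<open>u \<alpha>\<^sub>s > 0\<close>. Moreover
  \<open>u = a x\<close> with \<open>a \<in> W\<^sub>J\<close> and \<open>x\<close> the minimal element of \<open>p\<close>. Multiplication by \<open>a\<close> changes only
  the coordinates in \<open>J\<close>, so it can turn \<open>x \<alpha>\<^sub>s\<close> into a root of the other sign only if \<open>x \<alpha>\<^sub>s\<close> is
  supported in \<open>J\<close>. By minimality of \<open>x\<close> a positive root \<open>x \<alpha>\<^sub>s\<close> supported in \<open>J\<close> is a simple root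
  \<open>\<alpha>\<^sub>j\<close>, and then \<open>x s x\<^sup>-\<^sup>1 = j\<close>; in this case \<open>a \<alpha>\<^sub>j\<close> is negative by the maximality of \<open>v\<close>. A
  negative root \<open>x \<alpha>\<^sub>s\<close> is never supported in \<open>J\<close>, because \<open>x\<^sup>-\<^sup>1\<close> preserves signs there.
  Hence \<open>u \<alpha>\<^sub>s > 0\<close> means that \<open>x \<alpha>\<^sub>s > 0\<close>, that is,
  \<open>x\<close> is minimal in \<open>q\<close>, and that \<open>x s x\<^sup>-\<^sup>1\<close> is not in \<open>J\<close>, that is, the redundancy sets agree.

  The arguments rest on two facts about the geometric representation, which are proved first. The
  action is well defined, which is a computation with a rotation in the plane of two simple roots
  (\<open>dihedral_relation\<close>). And \<open>x \<alpha>\<^sub>s\<close> is positive if and only if \<open>xs\<close> is longer than \<open>x\<close>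
  (\<open>ascent_nonneg\<close>, \<open>descent_nonpos\<close>), which translates between lengths and signs. From these follows
  the description of the extreme elements of a double coset by signs (\<open>extremal_unique\<close>), which
  identifies the Bruhat-minimal and Bruhat-maximal elements.
\<close>

context coxeter_system
begin

section \<open>Words, length and parity\<close>

\<comment> \<open>Word lists are handled by the simplification rules for \<open>lists\<close>, not by their elements.\<close>
declare in_listsD [rule del] in_listsI [rule del]

lemma rev_in_lists [simp]: "rev ws \<in> lists A \<longleftrightarrow> ws \<in> lists A"
  by (simp add: lists_eq_set)

lemma word_prod_Nil [simp]: "word_prod W [] = \<one>"
  by (simp add: word_prod_def)

lemma word_prod_Cons [simp]: "word_prod W (s # ws) = s \<otimes> word_prod W ws"
  by (simp add: word_prod_def)

lemma S_closed [simp, intro]: "s \<in> S \<Longrightarrow> s \<in> carrier W"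
  using S_carrier by blast

lemma word_prod_closed [simp, intro]: "ws \<in> lists S \<Longrightarrow> word_prod W ws \<in> carrier W"
  by (induction ws) auto

lemma word_prod_append:
  "us \<in> lists S \<Longrightarrow> vs \<in> lists S \<Longrightarrow> word_prod W (us @ vs) = word_prod W us \<otimes> word_prod W vs"
  by (induction us) (auto simp: m_assoc)

lemma S_square [simp]: "s \<in> S \<Longrightarrow> s \<otimes> s = \<one>"
  using pow_ord_eq_1[of s] S_involution[of s] by (simp add: numeral_2_eq_2)

lemma S_inv [simp]: "s \<in> S \<Longrightarrow> inv s = s"
  by (rule inv_equality) auto

lemma S_cancel [simp]: "s \<in> S \<Longrightarrow> x \<in> carrier W \<Longrightarrow> x \<otimes> s \<otimes> s = x"
  by (simp add: m_assoc)

lemma S_cancel_left [simp]: "s \<in> S \<Longrightarrow> x \<in> carrier W \<Longrightarrow> s \<otimes> (s \<otimes> x) = x"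
  by (simp flip: m_assoc)

lemma word_prod_rev: "ws \<in> lists S \<Longrightarrow> word_prod W (rev ws) = inv (word_prod W ws)"
  by (induction ws) (auto simp: word_prod_append inv_mult_group)

lemma parabolic_word:
  assumes "I \<subseteq> S" "x \<in> parabolic I"
  obtains ws where "ws \<in> lists I" "word_prod W ws = x"
proof -
  have "\<exists>ws\<in>lists I. word_prod W ws = x"
    using assms(2) unfolding parabolic_def
  proof (induction rule: generate.induct)
    case one
    show ?case by (rule bexI[of _ "[]"]) auto
  next
    case (incl h)
    with assms(1) show ?case by (intro bexI[of _ "[h]"]) auto
  next
    case (inv h)
    with assms(1) have "h \<in> S" by blast
    with inv show ?case by (intro bexI[of _ "[h]"]) auto
  next
    case (eng h1 h2)
    then obtain us vs where "us \<in> lists I" "vs \<in> lists I" "word_prod W us = h1" "word_prod W vs = h2"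
      by blast
    with assms(1) show ?case
      using lists_mono[OF assms(1)]
      by (intro bexI[of _ "us @ vs"]) (auto simp: word_prod_append subset_iff)
  qed
  with that show thesis by blast
qed

lemma carrier_word:
  assumes "x \<in> carrier W"
  obtains ws where "ws \<in> lists S" "word_prod W ws = x"
  using parabolic_word[of S x] assms S_generates unfolding parabolic_def by blast

lemma len_le: "ws \<in> lists S \<Longrightarrow> len (word_prod W ws) \<le> length ws"
  unfolding len_def by (rule Least_le) blast

lemma reduced_word:
  assumes "x \<in> carrier W"
  obtains ws where "ws \<in> lists S" "word_prod W ws = x" "length ws = len x"
proof -
  have "\<exists>n. \<exists>ws\<in>lists S. length ws = n \<and> word_prod W ws = x"
    using assms by (metis carrier_word)
  from LeastI_ex[OF this] that show thesis unfolding len_def by blast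
qed

lemma len_mult_le:
  assumes "x \<in> carrier W" "y \<in> carrier W"
  shows "len (x \<otimes> y) \<le> len x + len y"
proof -
  obtain us where us: "us \<in> lists S" "word_prod W us = x" "length us = len x"
    using reduced_word[OF assms(1)] .
  obtain vs where vs: "vs \<in> lists S" "word_prod W vs = y" "length vs = len y"
    using reduced_word[OF assms(2)] .
  from len_le[of "us @ vs"] us vs show ?thesis by (simp add: word_prod_append)
qed

lemma len_inv:
  assumes "x \<in> carrier W"
  shows "len (inv x) = len x"
proof -
  have le: "len (inv y) \<le> len y" if y: "y \<in> carrier W" for y
  proof -
    obtain us where us: "us \<in> lists S" "word_prod W us = y" "length us = len y"
      using reduced_word[OF y] .
    with len_le[of "rev us"] show ?thesis by (simp add: word_prod_rev)
  qed
  from le[OF assms] le[of "inv x"] assms show ?thesis by simp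
qed

lemma len_one [simp]: "len \<one> = 0"
  using len_le[of "[]"] by simp

lemma len_S_le: "s \<in> S \<Longrightarrow> len s \<le> 1"
  using len_le[of "[s]"] by simp

text \<open>
  Every defining relation \<open>(st)\<^sup>m = 1\<close> has even length.
\<close>

lemma coxeter_eq_parity: "coxeter_eq W S us vs \<Longrightarrow> even (length us) = even (length vs)"
  by (induction rule: coxeter_eq.induct) (auto simp: length_concat sum_list_replicate)

text \<open>
  By parity, multiplication by a simple reflection always changes the length. So every simple
  reflection is either an ascent or a descent.
\<close>

lemma len_mult_S_neq:
  assumes "x \<in> carrier W" "s \<in> S"
  shows "len (x \<otimes> s) \<noteq> len x"
proof
  assume eq: "len (x \<otimes> s) = len x"
  obtain us where us: "us \<in> lists S" "word_prod W us = x" "length us = len x"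
    using reduced_word[OF assms(1)] .
  obtain vs where vs: "vs \<in> lists S" "word_prod W vs = x \<otimes> s" "length vs = len (x \<otimes> s)"
    using reduced_word[of "x \<otimes> s"] assms by blast
  have "word_prod W (us @ [s]) = word_prod W vs"
    using us vs assms by (simp add: word_prod_append)
  then have "coxeter_eq W S (us @ [s]) vs"
    using presentation[of "us @ [s]" vs] us vs assms by auto
  from coxeter_eq_parity[OF this] us vs eq show False by simp
qed

lemma S_descent:
  assumes "x \<in> carrier W" "x \<noteq> \<one>"
  obtains t where "t \<in> S" "len (x \<otimes> t) < len x"
proof -
  obtain us where us: "us \<in> lists S" "word_prod W us = x" "length us = len x"
    using reduced_word[OF assms(1)] .
  with assms have "us \<noteq> []" by auto
  then obtain vs t where eq: "us = vs @ [t]" by (metis rev_exhaust)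
  with us have "vs \<in> lists S" "t \<in> S" by auto
  with us eq have "x \<otimes> t = word_prod W vs" by (auto simp: word_prod_append)
  with len_le[OF \<open>vs \<in> lists S\<close>] us eq have "len (x \<otimes> t) < len x" by simp
  with that \<open>t \<in> S\<close> show thesis by blast
qed

section \<open>The geometric representation\<close>

definition root_space :: "('a \<Rightarrow> real) set" where
  "root_space = {v. finite {t. v t \<noteq> 0} \<and> {t. v t \<noteq> 0} \<subseteq> S}"

lemma root_space_finite: "v \<in> root_space \<Longrightarrow> finite {t. v t \<noteq> 0}"
  by (simp add: root_space_def)

lemma simple_root_in [simp, intro]: "s \<in> S \<Longrightarrow> simple_root s \<in> root_space"
  by (auto simp: root_space_def simple_root_def)

lemma root_space_lin [intro]:
  assumes "u \<in> root_space" "v \<in> root_space"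
  shows "(\<lambda>t. a * u t + b * v t) \<in> root_space"
proof -
  have "{t. a * u t + b * v t \<noteq> 0} \<subseteq> {t. u t \<noteq> 0} \<union> {t. v t \<noteq> 0}" by auto
  with assms show ?thesis
    unfolding root_space_def by (auto intro: finite_subset)
qed

lemma form_simple:
  assumes "finite A" "{t. v t \<noteq> 0} \<subseteq> A"
  shows "form (simple_root s) v = (\<Sum>t\<in>A. v t * gram s t)"
proof -
  have "{x. simple_root s x \<noteq> 0} = {s}" by (auto simp: simple_root_def)
  then have "form (simple_root s) v = (\<Sum>t | v t \<noteq> 0. v t * gram s t)"
    by (simp add: form_def) (simp add: simple_root_def)
  also have "\<dots> = (\<Sum>t\<in>A. v t * gram s t)"
    using assms by (intro sum.mono_neutral_left) auto
  finally show ?thesis .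
qed

lemma form_lin:
  assumes "u \<in> root_space" "v \<in> root_space"
  shows "form (simple_root s) (\<lambda>t. a * u t + b * v t) =
    a * form (simple_root s) u + b * form (simple_root s) v"
proof -
  let ?A = "{t. u t \<noteq> 0} \<union> {t. v t \<noteq> 0}"
  have fin: "finite ?A" using assms root_space_finite by auto
  have "form (simple_root s) (\<lambda>t. a * u t + b * v t) = (\<Sum>t\<in>?A. (a * u t + b * v t) * gram s t)"
    by (rule form_simple[OF fin]) auto
  also have "\<dots> = a * (\<Sum>t\<in>?A. u t * gram s t) + b * (\<Sum>t\<in>?A. v t * gram s t)"
    by (simp add: sum_distrib_left sum.distrib[symmetric] algebra_simps)
  also have "(\<Sum>t\<in>?A. u t * gram s t) = form (simple_root s) u"
    by (rule form_simple[OF fin, symmetric]) auto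
  also have "(\<Sum>t\<in>?A. v t * gram s t) = form (simple_root s) v"
    by (rule form_simple[OF fin, symmetric]) auto
  finally show ?thesis .
qed

lemma form_simple_root: "form (simple_root s) (simple_root t) = gram s t"
proof -
  have "form (simple_root s) (simple_root t) = (\<Sum>u\<in>{t}. simple_root t u * gram s u)"
    by (rule form_simple) (auto simp: simple_root_def)
  then show ?thesis by (simp add: simple_root_def)
qed

lemma gram_diag: "s \<in> S \<Longrightarrow> gram s s = 1"
  by (simp add: gram_def)

lemma ord_swap: "s \<in> S \<Longrightarrow> t \<in> S \<Longrightarrow> ord (t \<otimes> s) = ord (s \<otimes> t)"
  using ord_inv[of "s \<otimes> t"] by (simp add: inv_mult_group)

lemma gram_sym: "s \<in> S \<Longrightarrow> t \<in> S \<Longrightarrow> gram t s = gram s t"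
  by (simp add: gram_def ord_swap)

lemma simple_reflection_other: "t \<noteq> s \<Longrightarrow> simple_reflection s v t = v t"
  by (simp add: simple_reflection_def simple_root_def)

lemma simple_reflection_in:
  assumes "v \<in> root_space" "s \<in> S"
  shows "simple_reflection s v \<in> root_space"
  using root_space_lin[OF assms(1) simple_root_in[OF assms(2)], of 1 "- 2 * form (simple_root s) v"]
  by (simp add: simple_reflection_def)

lemma simple_reflection_lin:
  assumes "u \<in> root_space" "v \<in> root_space"
  shows "simple_reflection s (\<lambda>t. a * u t + b * v t) =
    (\<lambda>t. a * simple_reflection s u t + b * simple_reflection s v t)"
  by (simp add: simple_reflection_def form_lin[OF assms] algebra_simps fun_eq_iff)

lemma simple_reflection_root:
  assumes "s \<in> S"
  shows "simple_reflection s (simple_root s) = (\<lambda>t. - simple_root s t)"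
  using assms by (simp add: simple_reflection_def form_simple_root gram_diag fun_eq_iff)

lemma form_add_root:
  assumes "v \<in> root_space" "t \<in> S"
  shows "form (simple_root s) (\<lambda>u. v u + c * simple_root t u) = form (simple_root s) v + c * gram s t"
  using form_lin[OF assms(1) simple_root_in[OF assms(2)], of s 1 c] by (simp add: form_simple_root)

lemma simple_reflection_involution:
  assumes "v \<in> root_space" "s \<in> S"
  shows "simple_reflection s (simple_reflection s v) = v"
proof -
  define c where "c = form (simple_root s) v"
  have eq: "simple_reflection s v = (\<lambda>u. v u + (- 2 * c) * simple_root s u)"
    by (simp add: simple_reflection_def c_def)
  have "form (simple_root s) (simple_reflection s v) = - c"
    unfolding eq form_add_root[OF assms] by (simp add: gram_diag assms c_def)
  then show ?thesis
    by (subst simple_reflection_def) (simp add: eq)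
qed

lemma ord_neq_one:
  assumes "s \<in> S" "t \<in> S" "s \<noteq> t"
  shows "ord (s \<otimes> t) \<noteq> 1"
proof -
  have "s \<otimes> t \<noteq> \<one>" using assms by (metis S_closed S_inv inv_equality)
  then show ?thesis using assms ord_eq_1[of "s \<otimes> t"] by auto
qed

text \<open>
  The iterates of \<open>st\<close> on a vector \<open>v\<close> differ from \<open>v\<close> by a combination of the two simple roots, whose
  coefficients satisfy an affine recursion. As \<open>s \<noteq> t\<close> and the order \<open>m\<close> of \<open>st\<close> is finite, the form
  is nondegenerate on this plane, so the recursion has a fixed point. Relative to the fixed point it
  is the rotation by the angle \<open>2\<pi>/m\<close>, written in the basis of the two simple roots.
\<close>

lemma dihedral_relation:
  assumes v: "v \<in> root_space" and st: "s \<in> S" "t \<in> S" "s \<noteq> t" and m: "ord (s \<otimes> t) \<noteq> 0"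
  shows "((\<lambda>v. simple_reflection s (simple_reflection t v)) ^^ ord (s \<otimes> t)) v = v"
proof -
  define m where "m = ord (s \<otimes> t)"
  define \<theta> where "\<theta> = pi / real m"
  have "m \<noteq> 1" unfolding m_def by (rule ord_neq_one[OF st])
  with m have m2: "m \<ge> 2" unfolding m_def by simp
  then have "0 < \<theta>" "\<theta> < pi" by (auto simp: \<theta>_def field_simps)
  then have sin: "sin \<theta> > 0" by (rule sin_gt_zero)
  define c where "c = cos \<theta>"
  have gram: "gram s t = - c" "gram t s = - c"
    using m st by (simp_all add: gram_sym) (simp_all add: gram_def c_def \<theta>_def m_def)
  define A where "A = form (simple_root s) v"
  define B where "B = form (simple_root t) v"
  define d where "d = (sin \<theta>)\<^sup>2"
  have d: "d \<noteq> 0" "d = 1 - c\<^sup>2"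
  proof -
    show "d \<noteq> 0" using sin by (simp add: d_def)
    show "d = 1 - c\<^sup>2" unfolding d_def c_def by (rule sin_squared_eq)
  qed
  \<comment> \<open>\<open>(P0, Q0)\<close> is the fixed point: the solution of the linear system in \<open>fix1\<close> and \<open>fix2\<close>, of determinant \<open>d\<close>.\<close>
  define P0 where "P0 = - (A + c * B) / d"
  define Q0 where "Q0 = - (B + c * A) / d"
  have fix1: "A + P0 - c * Q0 = 0" and fix2: "B + Q0 - c * P0 = 0"
    using d by (auto simp: P0_def Q0_def divide_simps) (auto simp: algebra_simps power2_eq_square)
  \<comment> \<open>\<open>(p k, q k)\<close> is the deviation from the fixed point after \<open>k\<close> rotations, in closed form.\<close>
  define P1 where "P1 = - P0 / sin \<theta>"
  define Q1 where "Q1 = Q0 / sin \<theta>"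
  define p where "p k = P1 * sin ((2 * real k + 1) * \<theta>) + Q1 * sin (2 * real k * \<theta>)" for k
  define q where "q k = P1 * sin (2 * real k * \<theta>) + Q1 * sin ((2 * real k - 1) * \<theta>)" for k
  have sum_sin: "sin (x + \<theta>) = 2 * c * sin x - sin (x - \<theta>)" for x
    by (simp add: c_def sin_add sin_diff)
  have angle: "2 * real (Suc k) * \<theta> = (2 * real k + 1) * \<theta> + \<theta>"
    "(2 * real (Suc k) - 1) * \<theta> = 2 * real k * \<theta> + \<theta>"
    "(2 * real k + 1) * \<theta> - \<theta> = 2 * real k * \<theta>"
    "2 * real k * \<theta> - \<theta> = (2 * real k - 1) * \<theta>" for k
    by (simp_all add: algebra_simps)
  have qstep: "q (Suc k) = 2 * c * p k - q k" for k
    unfolding p_def q_def angle(1,2) sum_sin angle(3,4) by (simp add: algebra_simps)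
  have pstep: "p (Suc k) = 2 * c * q (Suc k) - p k" for k
  proof -
    define x where "x = 2 * real (Suc k) * \<theta>"
    define y where "y = (2 * real k + 1) * \<theta>"
    define z where "z = 2 * real k * \<theta>"
    have eqs: "(2 * real (Suc k) + 1) * \<theta> = x + \<theta>" "(2 * real (Suc k) - 1) * \<theta> = y"
      "x - \<theta> = y" "x = y + \<theta>" "y - \<theta> = z"
      by (simp_all add: x_def y_def z_def algebra_simps)
    have "sin (x + \<theta>) = 2 * c * sin x - sin y" "sin x = 2 * c * sin y - sin z"
      using sum_sin[of x] sum_sin[of y] eqs by simp_all
    then have "P1 * sin (x + \<theta>) + Q1 * sin x =
        P1 * (2 * c * sin x - sin y) + Q1 * (2 * c * sin y - sin z)"
      by metis
    then show ?thesis
      unfolding p_def q_def eqs(1,2) x_def[symmetric] y_def[symmetric] z_def[symmetric]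
      by (simp add: algebra_simps)
  qed
  have iter: "((\<lambda>v. simple_reflection s (simple_reflection t v)) ^^ k) v =
    (\<lambda>u. v u + (P0 + p k) * simple_root s u + (Q0 + q k) * simple_root t u)" for k
  proof (induction k)
    case 0
    have "p 0 = - P0" "q 0 = - Q0" using sin by (auto simp: p_def q_def P1_def Q1_def)
    then show ?case by simp
  next
    case (Suc k)
    let ?v = "\<lambda>P Q u. v u + P * simple_root s u + Q * simple_root t u"
    have in1: "(\<lambda>u. v u + P * simple_root s u) \<in> root_space" for P
      using root_space_lin[OF v simple_root_in[OF st(1)], of 1 P] by simp
    have ft: "form (simple_root t) (?v P Q) = B - c * P + Q" for P Q
      using form_add_root[OF in1 st(2)] form_add_root[OF v st(1)] st
      by (simp add: gram gram_diag B_def)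
    have fs: "form (simple_root s) (?v P Q) = A + P - c * Q" for P Q
      using form_add_root[OF in1 st(2)] form_add_root[OF v st(1)] st
      by (simp add: gram gram_diag A_def)
    have rt: "simple_reflection t (?v P Q) = ?v P (2 * c * P - Q - 2 * B)" for P Q
      unfolding simple_reflection_def ft by (simp add: algebra_simps fun_eq_iff)
    have rs: "simple_reflection s (?v P Q) = ?v (2 * c * Q - P - 2 * A) Q" for P Q
      unfolding simple_reflection_def fs by (simp add: algebra_simps fun_eq_iff)
    have 1: "2 * c * (P0 + p k) - (Q0 + q k) - 2 * B = Q0 + q (Suc k)"
      using fix2 by (simp add: qstep algebra_simps)
    have 2: "2 * c * (Q0 + q (Suc k)) - (P0 + p k) - 2 * A = P0 + p (Suc k)"
      using fix1 by (simp add: pstep algebra_simps)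
    show ?case unfolding funpow.simps comp_apply Suc.IH rt rs 1 2 ..
  qed
  have "real m * \<theta> = pi" using m2 by (simp add: \<theta>_def)
  then have 1: "2 * real m * \<theta> = 2 * pi" "(2 * real m + 1) * \<theta> = \<theta> + 2 * pi"
    "(2 * real m - 1) * \<theta> = - \<theta> + 2 * pi"
    by (simp_all add: algebra_simps)
  have "p m = - P0" "q m = - Q0"
    unfolding p_def q_def 1 sin_periodic using sin by (auto simp: P1_def Q1_def)
  with iter[of m] show ?thesis by (simp add: m_def)
qed

definition word_act :: "'a list \<Rightarrow> ('a \<Rightarrow> real) \<Rightarrow> 'a \<Rightarrow> real" where
  "word_act ws = foldr simple_reflection ws"

lemma word_act_simps [simp]:
  "word_act [] v = v"
  "word_act (s # ws) v = simple_reflection s (word_act ws v)"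
  "word_act (us @ vs) v = word_act us (word_act vs v)"
  by (simp_all add: word_act_def)

lemma word_act_in: "ws \<in> lists S \<Longrightarrow> v \<in> root_space \<Longrightarrow> word_act ws v \<in> root_space"
  by (induction ws) (auto intro: simple_reflection_in)

lemma word_act_replicate:
  "word_act (concat (replicate n [s, t])) v =
    ((\<lambda>v. simple_reflection s (simple_reflection t v)) ^^ n) v"
  by (induction n) auto

text \<open>
  Invariance under the congruence of the presentation is what makes \<open>act\<close> independent of the
  word chosen in its definition.
\<close>

lemma coxeter_eq_word_act:
  "coxeter_eq W S us vs \<Longrightarrow> v \<in> root_space \<Longrightarrow> word_act us v = word_act vs v"
proof (induction rule: coxeter_eq.induct)
  case (relation us vs s t)
  have *: "word_act vs v \<in> root_space" using relation word_act_in by blast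
  show ?case
  proof (cases "s = t")
    case True
    with relation * simple_reflection_involution[of "word_act vs v" t] show ?thesis by simp
  next
    case False
    with relation dihedral_relation[OF *, of s t] show ?thesis by (simp add: word_act_replicate)
  qed
qed auto

lemma act_word:
  assumes "ws \<in> lists S" "v \<in> root_space"
  shows "act (word_prod W ws) v = word_act ws v"
proof -
  let ?us = "SOME us. us \<in> lists S \<and> word_prod W us = word_prod W ws"
  have us: "?us \<in> lists S \<and> word_prod W ?us = word_prod W ws"
    by (rule someI[of _ ws]) (use assms in blast)
  then have "coxeter_eq W S ?us ws" using presentation[of ?us ws] assms by blast
  from coxeter_eq_word_act[OF this assms(2)] show ?thesis by (simp add: act_def word_act_def)
qed

lemma act_in [simp, intro]: "x \<in> carrier W \<Longrightarrow> v \<in> root_space \<Longrightarrow> act x v \<in> root_space"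
  using act_word[of _ v] word_act_in[of _ v] by (auto elim!: carrier_word)

lemma act_one [simp]: "v \<in> root_space \<Longrightarrow> act \<one> v = v"
  using act_word[of "[]" v] by simp

lemma act_S: "s \<in> S \<Longrightarrow> v \<in> root_space \<Longrightarrow> act s v = simple_reflection s v"
  using act_word[of "[s]" v] by simp

lemma act_mult:
  assumes "x \<in> carrier W" "y \<in> carrier W" "v \<in> root_space"
  shows "act (x \<otimes> y) v = act x (act y v)"
proof -
  obtain us vs where *: "us \<in> lists S" "word_prod W us = x" "vs \<in> lists S" "word_prod W vs = y"
    using assms by (metis carrier_word)
  have "act (x \<otimes> y) v = word_act us (word_act vs v)"
    using * assms act_word[of "us @ vs" v] by (simp add: word_prod_append)
  also have "\<dots> = act x (act y v)"
    using * assms act_word[of vs v] act_word[of us "word_act vs v"] by (simp add: word_act_in)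
  finally show ?thesis .
qed

lemma act_inv_cancel [simp]:
  assumes "x \<in> carrier W" "v \<in> root_space"
  shows "act (inv x) (act x v) = v" "act x (act (inv x) v) = v"
  using act_mult[of "inv x" x v] act_mult[of x "inv x" v] assms by auto

lemma word_act_lin:
  assumes "ws \<in> lists S" "u \<in> root_space" "v \<in> root_space"
  shows "word_act ws (\<lambda>t. a * u t + b * v t) = (\<lambda>t. a * word_act ws u t + b * word_act ws v t)"
  using assms
  by (induction ws) (auto simp: simple_reflection_lin word_act_in)

lemma act_lin:
  assumes "x \<in> carrier W" "u \<in> root_space" "v \<in> root_space"
  shows "act x (\<lambda>t. a * u t + b * v t) = (\<lambda>t. a * act x u t + b * act x v t)"
proof -
  obtain ws where ws: "ws \<in> lists S" "word_prod W ws = x"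
    using carrier_word[OF assms(1)] .
  have "act x v = word_act ws v" if "v \<in> root_space" for v
    using act_word[OF ws(1) that] ws(2) by simp
  with word_act_lin[OF ws(1) assms(2,3), of a b] assms(2,3) show ?thesis
    by (simp add: root_space_lin)
qed

lemma act_scale:
  assumes "x \<in> carrier W" "u \<in> root_space"
  shows "act x (\<lambda>t. a * u t) = (\<lambda>t. a * act x u t)"
  using act_lin[OF assms assms(2), of a 0] by simp

text \<open>
  The image of a vector is determined by the images of the simple roots in its support. This is the
  form of linearity from which all sign arguments start.
\<close>

lemma act_expand:
  assumes x: "x \<in> carrier W" and v: "v \<in> root_space" and A: "finite A" "{t. v t \<noteq> 0} \<subseteq> A" "A \<subseteq> S"
  shows "act x v u = (\<Sum>t\<in>A. v t * act x (simple_root t) u)"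
  using A v
proof (induction A arbitrary: v u rule: finite_induct)
  case empty
  then have "v = (\<lambda>t. 0)" by auto
  with act_scale[OF x empty.prems(3), of 0] show ?case by simp
next
  case (insert t A)
  define v' where "v' = (\<lambda>u. if u = t then 0 else v u)"
  have v: "v = (\<lambda>u. 1 * v' u + v t * simple_root t u)"
    by (auto simp: v'_def simple_root_def)
  have v': "v' \<in> root_space"
    using insert.prems by (auto simp: root_space_def v'_def elim: rev_finite_subset)
  have "act x v u = act x v' u + v t * act x (simple_root t) u"
    using act_lin[OF x v' simple_root_in, of t 1 "v t"] insert.prems v by simp
  also have "act x v' u = (\<Sum>t\<in>A. v' t * act x (simple_root t) u)"
    using insert.prems v' by (intro insert.IH) (auto simp: v'_def)
  also have "\<dots> = (\<Sum>t\<in>A. v t * act x (simple_root t) u)"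
    using insert.hyps by (intro sum.cong) (auto simp: v'_def)
  finally show ?case using insert.hyps by simp
qed

section \<open>Positive and negative roots\<close>

abbreviation nonneg :: "('a \<Rightarrow> real) \<Rightarrow> bool" where
  "nonneg v \<equiv> \<forall>t. 0 \<le> v t"

text \<open>
  The alternating word \<open>\<dots> s t\<close> of length \<open>k\<close> that ends in \<open>t\<close>. It grows at the left end, which is
  the order in which the reflections act.
\<close>

primrec alt_word :: "'a \<Rightarrow> 'a \<Rightarrow> nat \<Rightarrow> 'a list" where
  "alt_word s t 0 = []"
| "alt_word s t (Suc k) = (if even k then t else s) # alt_word s t k"

lemma alt_word_snoc: "alt_word s t (Suc k) = alt_word t s k @ [t]"
proof (induction k)
  case (Suc k)
  have "alt_word s t (Suc (Suc k)) = (if even k then s else t) # alt_word s t (Suc k)"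
    by (simp only: alt_word.simps(2)[of s t "Suc k"] even_Suc) simp
  then show ?case unfolding Suc.IH by simp
qed simp

lemma alt_word_in: "s \<in> S \<Longrightarrow> t \<in> S \<Longrightarrow> alt_word s t k \<in> lists S"
  by (induction k) auto

lemma length_alt_word: "length (alt_word s t k) = k"
  by (induction k) auto

lemma alt_word_even_prod:
  assumes "s \<in> S" "t \<in> S"
  shows "word_prod W (alt_word s t (2 * k)) = (s \<otimes> t) [^] k"
proof (induction k)
  case (Suc k)
  have "word_prod W (alt_word s t (2 * Suc k)) = s \<otimes> (t \<otimes> word_prod W (alt_word s t (2 * k)))"
    by simp
  also have "\<dots> = (s \<otimes> t) \<otimes> (s \<otimes> t) [^] k"
    using assms by (simp add: Suc.IH m_assoc)
  also have "\<dots> = (s \<otimes> t) [^] Suc k"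
    using assms by (metis S_closed m_closed nat_pow_Suc2)
  finally show ?case .
qed simp

lemma alt_word_suffix:
  assumes "j \<le> n" "s \<in> S" "t \<in> S"
  obtains us where "us \<in> lists S" "length us = n - j" "alt_word s t n = us @ alt_word s t j"
proof -
  have "\<exists>us\<in>lists S. length us = n - j \<and> alt_word s t n = us @ alt_word s t j"
    using assms(1)
  proof (induction rule: dec_induct)
    case base
    show ?case by (intro bexI[of _ "[]"]) auto
  next
    case (step n)
    then obtain us where us: "us \<in> lists S" "length us = n - j" "alt_word s t n = us @ alt_word s t j"
      by blast
    with step assms show ?case
      by (intro bexI[of _ "(if even n then t else s) # us"]) auto
  qed
  with that show thesis by blast
qed

text \<open>
  Let \<open>m\<close> be the order of \<open>st\<close>. An alternating word with more than \<open>m\<close> letters ends with one of length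
  \<open>m + 1\<close>, and by the relation \<open>(st)\<^sup>m = 1\<close> the inverse of the latter is a word of length \<open>m - 1\<close>.
\<close>

lemma len_alt_word_less:
  assumes "s \<in> S" "t \<in> S" and m: "ord (s \<otimes> t) \<noteq> 0" "ord (s \<otimes> t) \<le> k"
  shows "len (word_prod W (alt_word s t (Suc k))) < k"
proof -
  let ?m = "ord (s \<otimes> t)"
  have le: "Suc ?m \<le> 2 * ?m" "Suc ?m \<le> Suc k" using m by auto
  obtain us where us: "us \<in> lists S" "length us = 2 * ?m - Suc ?m"
    "alt_word s t (2 * ?m) = us @ alt_word s t (Suc ?m)"
    using alt_word_suffix[OF le(1) assms(1,2)] .
  obtain vs where vs: "vs \<in> lists S" "length vs = Suc k - Suc ?m"
    "alt_word s t (Suc k) = vs @ alt_word s t (Suc ?m)"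
    using alt_word_suffix[OF le(2) assms(1,2)] .
  let ?a = "word_prod W (alt_word s t (Suc ?m))"
  have in_S: "alt_word s t (Suc ?m) \<in> lists S" using alt_word_in[OF assms(1,2)] .
  have "word_prod W us \<otimes> ?a = \<one>"
    using us(1) in_S alt_word_even_prod[OF assms(1,2), of ?m] assms
    unfolding us(3) by (simp only: word_prod_append) (simp add: pow_ord_eq_1)
  then have "?a = inv (word_prod W us)"
    using us(1) in_S by (metis inv_equality inv_inv word_prod_closed)
  then have "len ?a \<le> ?m - 1"
    using us len_le[OF us(1)] by (simp add: len_inv)
  moreover have "len (word_prod W (alt_word s t (Suc k))) \<le> (k - ?m) + len ?a"
    using len_mult_le[of "word_prod W vs" ?a] len_le[OF vs(1)] vs in_S
    unfolding vs(3) by (simp only: word_prod_append) fastforce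
  ultimately show ?thesis using m by linarith
qed

text \<open>
  The values at \<open>c\<close> of the Chebyshev polynomials of the second kind, with the index shifted by one:
  \<open>chebyshev (cos \<theta>) n = sin (n \<theta>) / sin \<theta>\<close>. They are the coefficients of the roots in a dihedral
  subsystem.
\<close>

fun chebyshev :: "real \<Rightarrow> nat \<Rightarrow> real" where
  "chebyshev c 0 = 0"
| "chebyshev c (Suc 0) = 1"
| "chebyshev c (Suc (Suc n)) = 2 * c * chebyshev c (Suc n) - chebyshev c n"

lemma chebyshev_cos: "chebyshev (cos \<theta>) n * sin \<theta> = sin (real n * \<theta>)"
proof (induction "cos \<theta>" n rule: chebyshev.induct)
  case (3 n)
  have "sin (real (Suc (Suc n)) * \<theta>) = sin (real (Suc n) * \<theta> + \<theta>)"
    by (simp add: algebra_simps)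
  also have "\<dots> = 2 * cos \<theta> * sin (real (Suc n) * \<theta>) - sin (real (Suc n) * \<theta> - \<theta>)"
    by (simp add: sin_add sin_diff)
  also have "real (Suc n) * \<theta> - \<theta> = real n * \<theta>" by (simp add: algebra_simps)
  finally show ?case
    using 3 by (simp add: algebra_simps del: of_nat_Suc)
qed auto

lemma chebyshev_one: "chebyshev 1 n = real n"
  by (induction "1::real" n rule: chebyshev.induct) auto

text \<open>
  Let \<open>m\<close> be the order of \<open>st\<close>. For finite \<open>m\<close> the angle \<open>\<theta> = \<pi>/m\<close> gives \<open>n \<theta> \<le> \<pi>\<close>; for \<open>m = \<infinity>\<close> the value is \<open>n\<close>.
\<close>

lemma chebyshev_nonneg:
  assumes "s \<in> S" "t \<in> S" "s \<noteq> t" "ord (s \<otimes> t) = 0 \<or> n \<le> ord (s \<otimes> t)"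
  shows "chebyshev (- gram s t) n \<ge> 0"
proof (cases "ord (s \<otimes> t) = 0")
  case True
  then show ?thesis by (simp add: gram_def chebyshev_one)
next
  case False
  let ?\<theta> = "pi / real (ord (s \<otimes> t))"
  have m: "ord (s \<otimes> t) \<ge> 2" "n \<le> ord (s \<otimes> t)"
    using False ord_neq_one[OF assms(1-3)] assms(4) by linarith+
  then have "0 < ?\<theta>" "?\<theta> < pi" by (auto simp: field_simps)
  then have "sin ?\<theta> > 0" by (rule sin_gt_zero)
  moreover have "sin (real n * ?\<theta>) \<ge> 0"
    using m by (intro sin_ge_zero) (auto simp: field_simps)
  ultimately have "chebyshev (cos ?\<theta>) n \<ge> 0"
    using chebyshev_cos[of ?\<theta> n] by (metis zero_le_mult_iff not_le)
  then show ?thesis using False by (simp add: gram_def)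
qed

lemma simple_reflection_pair:
  assumes "s \<in> S" "t \<in> S"
  shows "simple_reflection t (\<lambda>u. a * simple_root s u + b * simple_root t u) =
    (\<lambda>u. a * simple_root s u + (2 * (- gram s t) * a - b) * simple_root t u)"
  unfolding simple_reflection_def form_lin[OF simple_root_in simple_root_in, OF assms]
  using assms
  by (simp add: form_simple_root gram_diag gram_sym fun_eq_iff algebra_simps)

lemma alt_word_act:
  assumes "s \<in> S" "t \<in> S"
  shows "word_act (alt_word s t k) (simple_root s) =
    (\<lambda>u. chebyshev (- gram s t) (Suc k) * simple_root (if even k then s else t) u
      + chebyshev (- gram s t) k * simple_root (if even k then t else s) u)"
proof (induction k)
  case (Suc k)
  have sym: "gram t s = gram s t" using assms by (simp add: gram_sym)
  show ?case
  proof (cases "even k")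
    case True
    then have "word_act (alt_word s t (Suc k)) (simple_root s) = simple_reflection t
      (\<lambda>u. chebyshev (- gram s t) (Suc k) * simple_root s u + chebyshev (- gram s t) k * simple_root t u)"
      by (simp only: alt_word.simps word_act_simps Suc.IH if_True)
    with True show ?thesis
      unfolding simple_reflection_pair[OF assms] by (simp add: add.commute)
  next
    case False
    then have "word_act (alt_word s t (Suc k)) (simple_root s) = simple_reflection s
      (\<lambda>u. chebyshev (- gram s t) (Suc k) * simple_root t u + chebyshev (- gram s t) k * simple_root s u)"
      by (simp only: alt_word.simps word_act_simps Suc.IH if_False)
    with False show ?thesis
      unfolding simple_reflection_pair[OF assms(2,1)] by (simp add: sym add.commute)
  qed
qed simp

text \<open>
  Induction on the length of \<open>x\<close>. For a descent \<open>t\<close> of \<open>x\<close> write \<open>x = v d\<close> with lengths adding, where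
  \<open>d\<close> is an alternating word in \<open>s\<close> and \<open>t\<close> ending in \<open>t\<close> of the greatest possible length \<open>k\<close>. Then both
  \<open>s\<close> and \<open>t\<close> are ascents of \<open>v\<close>, so \<open>v\<close> maps both simple roots to nonnegative vectors. As \<open>s\<close> is an
  ascent of \<open>x\<close>, the length \<open>k\<close> is less than the order of \<open>st\<close>, hence \<open>d \<alpha>\<^sub>s\<close> is a nonnegative
  combination of the two simple roots.
\<close>

theorem ascent_nonneg:
  assumes "x \<in> carrier W" "s \<in> S" "len x < len (x \<otimes> s)"
  shows "nonneg (act x (simple_root s))"
  using assms
proof (induction "len x" arbitrary: x s rule: less_induct)
  case less
  note x = less.prems(1) and s = less.prems(2)
  show ?case
  proof (cases "x = \<one>")
    case True
    with s have "act x (simple_root s) = simple_root s" by simp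
    then show ?thesis by (simp add: simple_root_def)
  next
    case False
    obtain t where t: "t \<in> S" "len (x \<otimes> t) < len x"
      using S_descent[OF x False] .
    have "s \<noteq> t" using t less.prems by auto
    define P where "P k \<longleftrightarrow> (\<exists>v\<in>carrier W.
      x = v \<otimes> word_prod W (alt_word s t k) \<and> len x = len v + k)" for k
    have "len x \<le> len (x \<otimes> t) + len t"
      using len_mult_le[of "x \<otimes> t" t] x t by simp
    with t len_S_le[of t] have "len x = len (x \<otimes> t) + 1" by linarith
    then have P1: "P 1"
      unfolding P_def using x t by (intro bexI[of _ "x \<otimes> t"]) auto
    have bound: "k \<le> len x" if "P k" for k using that by (auto simp: P_def)
    define k where "k = (GREATEST k. P k)"
    have Pk: "P k" unfolding k_def by (rule GreatestI_nat[of P, OF P1 bound])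
    have max: "j \<le> k" if "P j" for j
      unfolding k_def by (rule Greatest_le_nat[of P, OF that bound])
    obtain v where v: "v \<in> carrier W" "x = v \<otimes> word_prod W (alt_word s t k)" "len x = len v + k"
      using Pk by (auto simp: P_def)
    have k1: "k \<ge> 1" using max[OF P1] .
    \<comment> \<open>\<open>a\<close> is the letter that would extend the alternating word at its left end, \<open>b\<close> is its leftmost letter.\<close>
    define a where "a = (if even k then t else s)"
    define b where "b = (if even k then s else t)"
    have ab: "a \<in> S" "b \<in> S" using s t by (auto simp: a_def b_def)
    have alt: "word_prod W (alt_word s t j) \<in> carrier W" for j
      using alt_word_in[OF s t(1)] by blast
    \<comment> \<open>Otherwise the alternating word could be lengthened.\<close>
    have "\<not> len (v \<otimes> a) < len v"
    proof
      assume less_a: "len (v \<otimes> a) < len v"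
      have "len v \<le> len (v \<otimes> a) + len a"
        using len_mult_le[of "v \<otimes> a" a] v ab by simp
      with less_a len_S_le[OF ab(1)] have "len v = len (v \<otimes> a) + 1" by linarith
      moreover have "v \<otimes> a \<otimes> word_prod W (alt_word s t (Suc k)) = x"
        using v ab alt by (simp add: a_def[symmetric] m_assoc)
      ultimately have "P (Suc k)"
        unfolding P_def using v ab by (intro bexI[of _ "v \<otimes> a"]) auto
      from max[OF this] show False by simp
    qed
    then have va: "len v < len (v \<otimes> a)" using len_mult_S_neq[OF v(1) ab(1)] by linarith
    \<comment> \<open>Otherwise \<open>b\<close> would cancel against the alternating word, and \<open>x\<close> would be shorter.\<close>
    have "\<not> len (v \<otimes> b) < len v"
    proof
      assume less_b: "len (v \<otimes> b) < len v"
      obtain j where j: "k = Suc j" using k1 by (cases k) auto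
      have "x = (v \<otimes> b) \<otimes> word_prod W (alt_word s t j)"
        using v ab alt j by (auto simp: b_def m_assoc)
      moreover have "len (word_prod W (alt_word s t j)) \<le> j"
        using len_le[OF alt_word_in[OF s t(1)], of j] by (simp add: length_alt_word)
      ultimately have "len x \<le> len (v \<otimes> b) + j"
        using len_mult_le[of "v \<otimes> b" "word_prod W (alt_word s t j)"] v ab alt by simp
      with less_b v j show False by simp
    qed
    then have vb: "len v < len (v \<otimes> b)" using len_mult_S_neq[OF v(1) ab(2)] by linarith
    have "len v < len x" using v k1 by simp
    then have pos: "nonneg (act v (simple_root a))" "nonneg (act v (simple_root b))"
      using less.hyps v ab va vb by auto
    \<comment> \<open>Otherwise the alternating word followed by \<open>s\<close> is too long to be reduced, and \<open>s\<close> is no ascent.\<close>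
    have small: "ord (s \<otimes> t) = 0 \<or> k < ord (s \<otimes> t)"
    proof (rule ccontr)
      assume "\<not> ?thesis"
      then have big: "ord (t \<otimes> s) \<noteq> 0" "ord (t \<otimes> s) \<le> k" using s t ord_swap by auto
      have "x \<otimes> s = v \<otimes> word_prod W (alt_word t s (Suc k))"
        unfolding alt_word_snoc[of t s k] using v s t alt alt_word_in[OF s t(1)]
        by (simp add: word_prod_append m_assoc)
      then have "len (x \<otimes> s) \<le> len v + len (word_prod W (alt_word t s (Suc k)))"
        using len_mult_le v(1) alt_word_in[OF t(1) s] by (metis word_prod_closed)
      also have "\<dots> < len v + k" using len_alt_word_less[OF t(1) s big] by simp
      finally show False using less.prems(3) v by simp
    qed
    define U where "U = chebyshev (- gram s t)"
    have "U j \<ge> 0" if "ord (s \<otimes> t) = 0 \<or> j \<le> ord (s \<otimes> t)" for j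
      unfolding U_def using chebyshev_nonneg[OF s t(1) \<open>s \<noteq> t\<close> that] .
    then have U: "U k \<ge> 0" "U (Suc k) \<ge> 0" using small by auto
    have "act x (simple_root s) = act v (word_act (alt_word s t k) (simple_root s))"
      using act_word[OF alt_word_in[OF s t(1)] simple_root_in[OF s], of k] act_mult v alt s by simp
    also have "\<dots> = act v (\<lambda>u. U (Suc k) * simple_root b u + U k * simple_root a u)"
      unfolding alt_word_act[OF s t(1)] by (simp add: a_def b_def U_def)
    also have "\<dots> = (\<lambda>u. U (Suc k) * act v (simple_root b) u + U k * act v (simple_root a) u)"
      using act_lin v ab by blast
    finally show ?thesis using pos U by auto
  qed
qed

lemma act_mult_S_root:
  assumes "x \<in> carrier W" "s \<in> S"
  shows "act (x \<otimes> s) (simple_root s) = (\<lambda>t. - act x (simple_root s) t)"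
  using act_mult[of x s "simple_root s"] act_scale[of x "simple_root s" "- 1"] assms
  by (simp add: act_S simple_reflection_root)

lemma descent_nonpos:
  assumes "x \<in> carrier W" "s \<in> S" "len (x \<otimes> s) < len x"
  shows "act x (simple_root s) t \<le> 0"
  using ascent_nonneg[of "x \<otimes> s" s] assms act_mult_S_root[OF assms(1,2)] by (simp add: le_funD)

lemma act_eq_zero:
  assumes "x \<in> carrier W" "v \<in> root_space" "\<And>t. act x v t = 0"
  shows "v t = 0"
proof -
  have z: "act x v = (\<lambda>t. 0 * act x v t)" using assms by auto
  have "v = act (inv x) (act x v)" using assms by simp
  also have "\<dots> = (\<lambda>t. 0)"
    using act_scale[of "inv x" "act x v" 0] z assms by simp
  finally show ?thesis by simp
qed

lemma act_simple_root_nonzero: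
  assumes "x \<in> carrier W" "s \<in> S"
  obtains t where "act x (simple_root s) t \<noteq> 0"
proof -
  have "simple_root s s \<noteq> 0" by (simp add: simple_root_def)
  with act_eq_zero[OF assms(1) simple_root_in[OF assms(2)], of s] that show thesis by blast
qed

lemma nonneg_iff_ascent:
  assumes "x \<in> carrier W" "s \<in> S"
  shows "nonneg (act x (simple_root s)) \<longleftrightarrow> len x < len (x \<otimes> s)"
proof
  assume pos: "nonneg (act x (simple_root s))"
  obtain t where "act x (simple_root s) t \<noteq> 0" using act_simple_root_nonzero[OF assms] .
  with pos have "act x (simple_root s) t > 0" by (simp add: order_less_le)
  then have "\<not> len (x \<otimes> s) < len x" using descent_nonpos[OF assms, of t] by auto
  with len_mult_S_neq[OF assms] show "len x < len (x \<otimes> s)" by linarith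
qed (use ascent_nonneg assms in blast)

abbreviation support :: "('a \<Rightarrow> real) \<Rightarrow> 'a set" where
  "support v \<equiv> {t. v t \<noteq> 0}"

lemma simple_root_self [simp]: "simple_root s s = 1"
  by (simp add: simple_root_def)

lemma support_simple_root: "support (simple_root s) = {s}"
  by (auto simp: simple_root_def)

lemma root_in_space [simp, intro]: "\<gamma> \<in> roots \<Longrightarrow> \<gamma> \<in> root_space"
  by (auto simp: roots_def)

lemma simple_root_roots [simp, intro]: "s \<in> S \<Longrightarrow> simple_root s \<in> roots"
  unfolding roots_def by (rule CollectI, rule exI[of _ \<one>], rule exI[of _ s]) auto

lemma rootI: "w \<in> carrier W \<Longrightarrow> s \<in> S \<Longrightarrow> act w (simple_root s) \<in> roots"
  by (auto simp: roots_def)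

lemma rootE:
  assumes "\<gamma> \<in> roots"
  obtains w s where "w \<in> carrier W" "s \<in> S" "\<gamma> = act w (simple_root s)"
  using assms by (auto simp: roots_def)

lemma act_roots [simp, intro]:
  assumes "\<gamma> \<in> roots" "x \<in> carrier W"
  shows "act x \<gamma> \<in> roots"
proof -
  obtain w s where w: "w \<in> carrier W" "s \<in> S" "\<gamma> = act w (simple_root s)"
    using rootE[OF assms(1)] .
  with rootI[of "x \<otimes> w" s] assms(2) show ?thesis by (simp add: act_mult)
qed

lemma root_uminus:
  assumes "\<gamma> \<in> roots"
  shows "(\<lambda>t. - \<gamma> t) \<in> roots"
proof -
  obtain w s where w: "w \<in> carrier W" "s \<in> S" "\<gamma> = act w (simple_root s)"
    using rootE[OF assms] .
  with rootI[of "w \<otimes> s" s] show ?thesis by (simp add: act_mult_S_root)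
qed

lemma root_sign:
  assumes "\<gamma> \<in> roots"
  shows "nonneg \<gamma> \<or> (\<forall>t. \<gamma> t \<le> 0)"
proof -
  obtain w s where "w \<in> carrier W" "s \<in> S" "\<gamma> = act w (simple_root s)"
    using assms by (auto simp: roots_def)
  with ascent_nonneg descent_nonpos len_mult_S_neq show ?thesis by (metis linorder_neqE_nat)
qed

lemma root_nonneg: "\<gamma> \<in> roots \<Longrightarrow> \<gamma> t > 0 \<Longrightarrow> nonneg \<gamma>"
  using root_sign[of \<gamma>] not_le by blast

lemma root_nonzero:
  assumes "\<gamma> \<in> roots"
  obtains t where "\<gamma> t \<noteq> 0"
  using assms act_simple_root_nonzero by (auto simp: roots_def)

lemma nonneg_uminus_root:
  assumes "\<gamma> \<in> roots"
  shows "nonneg (\<lambda>t. - \<gamma> t) \<longleftrightarrow> \<not> nonneg \<gamma>"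
proof
  assume neg: "nonneg (\<lambda>t. - \<gamma> t)"
  obtain t where "\<gamma> t \<noteq> 0" using root_nonzero[OF assms] .
  moreover have "\<gamma> t \<le> 0" using spec[OF neg, of t] by simp
  ultimately have "\<not> 0 \<le> \<gamma> t" by linarith
  then show "\<not> nonneg \<gamma>" by blast
next
  assume "\<not> nonneg \<gamma>"
  then have "\<forall>t. \<gamma> t \<le> 0" using root_sign[OF assms] by blast
  then show "nonneg (\<lambda>t. - \<gamma> t)" by simp
qed

text \<open>
  The factor \<open>e\<close> is \<open>1\<close> or \<open>-1\<close> in applications. It lets minimal and maximal elements be treated
  together.
\<close>

lemma act_nonneg:
  assumes x: "x \<in> carrier W" and v: "v \<in> root_space" "support v \<subseteq> I" "nonneg v"
    and I: "\<And>i t. i \<in> I \<Longrightarrow> 0 \<le> e * act x (simple_root i) t"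
  shows "0 \<le> e * act x v t"
proof -
  have "e * act x v t = (\<Sum>i\<in>support v. v i * (e * act x (simple_root i) t))"
    using act_expand[OF x v(1), of "support v" t] v(1)
    by (auto simp: root_space_def sum_distrib_left mult_ac)
  also have "\<dots> \<ge> 0" using v I by (intro sum_nonneg mult_nonneg_nonneg[of _ "e * _"]) auto
  finally show ?thesis .
qed

text \<open>
  If a coordinate of a combination vanishes and all its contributions have the same sign, then each
  contribution vanishes.
\<close>

lemma act_zero_coordinate:
  assumes x: "x \<in> carrier W" and v: "v \<in> root_space"
    and pos: "\<And>i. i \<in> support v \<Longrightarrow> 0 \<le> d * v i * (e * act x (simple_root i) t)"
    and zero: "act x v t = 0" and i: "i \<in> support v" and "d \<noteq> 0" "e \<noteq> 0"
  shows "act x (simple_root i) t = 0"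
proof -
  have fin: "finite (support v)" using v by (simp add: root_space_def)
  have "(\<Sum>i\<in>support v. d * v i * (e * act x (simple_root i) t)) = d * e * act x v t"
    using act_expand[OF x v, of "support v" t] v
    by (auto simp: root_space_def sum_distrib_left mult_ac)
  then have "\<forall>i\<in>support v. d * v i * (e * act x (simple_root i) t) = 0"
    using sum_nonneg_eq_0_iff[OF fin, of "\<lambda>i. d * v i * (e * act x (simple_root i) t)"] pos zero
    by simp
  with i assms(6,7) show ?thesis by auto
qed

lemma act_uminus: "x \<in> carrier W \<Longrightarrow> v \<in> root_space \<Longrightarrow> act x (\<lambda>t. - v t) = (\<lambda>t. - act x v t)"
  using act_scale[of x v "- 1"] by simp

text \<open>
  The reflections \<open>r = x i x\<^sup>-\<^sup>1\<close> and \<open>j\<close> agree because \<open>r j\<close> has no descent: it fixes the simple root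
  of \<open>j\<close>, and it fixes the coordinate at \<open>t\<close> of every other simple root \<open>\<alpha>\<^sub>t\<close>, so no simple root becomes
  negative. An element without descents is the identity.
\<close>

lemma simple_conjugate:
  assumes x: "x \<in> carrier W" and ij: "i \<in> S" "j \<in> S" and supp: "support (act x (simple_root i)) \<subseteq> {j}"
  shows "x \<otimes> i = j \<otimes> x"
proof -
  define c where "c = act x (simple_root i) j"
  have c: "act x (simple_root i) = (\<lambda>t. c * simple_root j t)"
  proof
    show "act x (simple_root i) t = c * simple_root j t" for t
      using supp by (cases "t = j") (auto simp: c_def simple_root_def[of j])
  qed
  obtain t where "act x (simple_root i) t \<noteq> 0" using act_simple_root_nonzero x ij(1) .
  with c have c0: "c \<noteq> 0" by auto
  define r where "r = x \<otimes> i \<otimes> inv x"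
  have r: "r \<in> carrier W" using x ij by (simp add: r_def)
  have r_act: "act r v = act x (simple_reflection i (act (inv x) v))" if "v \<in> root_space" for v
    using that x ij by (simp add: r_def act_mult act_S)
  have r_coord: "act r v t = v t" if v: "v \<in> root_space" "t \<noteq> j" for v t
  proof -
    define k where "k = - 2 * form (simple_root i) (act (inv x) v)"
    have "act r v = act x (\<lambda>t. 1 * act (inv x) v t + k * simple_root i t)"
      using v by (simp add: r_act simple_reflection_def k_def)
    also have "\<dots> = (\<lambda>t. 1 * v t + k * act x (simple_root i) t)"
      using x ij v act_lin[of x "act (inv x) v" "simple_root i" 1 k] by simp
    finally show ?thesis using that by (simp add: c simple_root_def[of j])
  qed
  have "act r (act x (simple_root i)) = (\<lambda>t. - act x (simple_root i) t)"
    using r_act[of "act x (simple_root i)"] x ij by (simp add: simple_reflection_root act_uminus)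
  then have "act r (\<lambda>t. c * simple_root j t) = (\<lambda>t. - (c * simple_root j t))"
    unfolding c .
  then have "c * act r (simple_root j) t = c * - simple_root j t" for t
    using act_scale[OF r simple_root_in[OF ij(2)], of c] by (simp add: fun_eq_iff)
  then have r_root: "act r (simple_root j) = (\<lambda>t. - simple_root j t)"
    using c0 mult_left_cancel by blast
  have "r \<otimes> j = \<one>"
  proof (rule ccontr)
    assume "r \<otimes> j \<noteq> \<one>"
    then obtain t where t: "t \<in> S" "len (r \<otimes> j \<otimes> t) < len (r \<otimes> j)"
      using S_descent[of "r \<otimes> j"] r ij by auto
    have "act (r \<otimes> j) (simple_root t) t = 1"
    proof (cases "t = j")
      case True
      then show ?thesis
        using act_mult_S_root[OF r ij(2)] r_root by simp
    next
      case False
      then show ?thesis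
        using r ij t r_coord[of "simple_reflection j (simple_root t)" t]
        by (simp add: act_mult act_S simple_reflection_in simple_reflection_other)
    qed
    moreover have "act (r \<otimes> j) (simple_root t) t \<le> 0"
      using descent_nonpos[of "r \<otimes> j" t] t r ij by simp
    ultimately show False by simp
  qed
  then have "r = j" using r ij by (metis S_closed S_inv inv_equality inv_inv)
  then show ?thesis using x ij by (auto simp: r_def m_assoc)
qed

section \<open>Parabolic subgroups\<close>

lemma parabolic_subgroup: "I \<subseteq> S \<Longrightarrow> subgroup (parabolic I) W"
  unfolding parabolic_def by (intro generate_is_subgroup) auto

lemma parabolic_closed:
  assumes "I \<subseteq> S"
  shows "\<one> \<in> parabolic I" "a \<in> parabolic I \<Longrightarrow> a \<in> carrier W" "a \<in> parabolic I \<Longrightarrow> inv a \<in> parabolic I"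
    "a \<in> parabolic I \<Longrightarrow> b \<in> parabolic I \<Longrightarrow> a \<otimes> b \<in> parabolic I"
  using parabolic_subgroup[OF assms] subgroup.one_closed subgroup.mem_carrier
    subgroup.m_inv_closed subgroup.m_closed by metis+

lemma parabolic_incl: "i \<in> I \<Longrightarrow> i \<in> parabolic I"
  by (simp add: parabolic_def generate.incl)

lemma parabolic_mono: "I \<subseteq> J \<Longrightarrow> parabolic I \<subseteq> parabolic J"
  unfolding parabolic_def by (rule mono_generate)

text \<open>
  Each simple reflection changes only the coordinate of its own simple root.
\<close>

lemma parabolic_act_coordinate:
  assumes "I \<subseteq> S" "a \<in> parabolic I" "v \<in> root_space" "t \<notin> I"
  shows "act a v t = v t"
proof -
  obtain ws where ws: "ws \<in> lists I" "word_prod W ws = a" using parabolic_word assms by blast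
  have "ws \<in> lists S" using ws assms(1) lists_mono by blast
  then have "act a v = word_act ws v" using act_word ws assms(3) by auto
  moreover have "word_act ws v t = v t"
    using ws(1)
  proof (induction ws)
    case (Cons s ws)
    then have "t \<noteq> s" using assms(4) by auto
    with Cons show ?case by (simp add: simple_reflection_other)
  qed simp
  ultimately show ?thesis by simp
qed

lemma parabolic_act_support:
  assumes "I \<subseteq> S" "a \<in> parabolic I" "v \<in> root_space" "support v \<subseteq> I"
  shows "support (act a v) \<subseteq> I"
  using parabolic_act_coordinate[OF assms(1-3)] assms(4) by force

lemma parabolic_descent:
  assumes "I \<subseteq> S" "c \<in> parabolic I" "c \<noteq> \<one>"
  obtains i where "i \<in> I" "\<forall>t. act c (simple_root i) t \<le> 0"
proof -
  have c: "c \<in> carrier W" using parabolic_closed(2) assms by blast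
  obtain t where t: "t \<in> S" "len (c \<otimes> t) < len c" using S_descent[OF c assms(3)] .
  have le: "act c (simple_root t) u \<le> 0" for u using descent_nonpos c t by blast
  have "t \<in> I" using le[of t] parabolic_act_coordinate[OF assms(1,2), of "simple_root t" t] t by force
  with le that show thesis by blast
qed

section \<open>Extremal elements of double cosets\<close>

text \<open>
  For \<open>e = 1\<close> these are the elements that become longer under every right multiplication by \<open>I\<close> and
  every left multiplication by \<open>J\<close>, for \<open>e = -1\<close> those that become shorter. Expressing both by signs
  of roots allows one proof for minimal and maximal elements of double cosets.
\<close>

definition extremal :: "real \<Rightarrow> 'a set \<Rightarrow> 'a set \<Rightarrow> 'a \<Rightarrow> bool" where
  "extremal e J I x \<longleftrightarrow> x \<in> carrier W \<and> (\<forall>i\<in>I. \<forall>t. 0 \<le> e * act x (simple_root i) t) \<and>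
    (\<forall>j\<in>J. \<forall>t. 0 \<le> e * act (inv x) (simple_root j) t)"

lemma extremalD:
  assumes "extremal e J I x"
  shows "x \<in> carrier W" "i \<in> I \<Longrightarrow> 0 \<le> e * act x (simple_root i) t"
    "j \<in> J \<Longrightarrow> 0 \<le> e * act (inv x) (simple_root j) t"
  using assms by (auto simp: extremal_def)

text \<open>
  Write \<open>x \<alpha>\<^sub>i\<close> as a combination of the simple roots in \<open>J\<close> and apply \<open>x\<^sup>-\<^sup>1\<close>: the simple root \<open>\<alpha>\<^sub>i\<close> is
  a sum of nonnegative vectors \<open>c\<^sub>j (x\<^sup>-\<^sup>1 \<alpha>\<^sub>j)\<close>. So each of them is a multiple of \<open>\<alpha>\<^sub>i\<close>,
  and \<open>simple_conjugate\<close> applies to \<open>x\<^sup>-\<^sup>1\<close>.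
\<close>

lemma extremal_simple_conjugate:
  assumes "extremal e J I x" "e \<noteq> 0" "J \<subseteq> S" "I \<subseteq> S" "i \<in> I"
    and supp: "support (act x (simple_root i)) \<subseteq> J"
  obtains j where "j \<in> J" "x \<otimes> i = j \<otimes> x"
proof -
  note x = extremalD[OF assms(1)]
  let ?v = "act x (simple_root i)"
  have i: "i \<in> S" using assms by blast
  have v: "?v \<in> root_space" "act (inv x) ?v = simple_root i" using x(1) i by auto
  obtain j where j: "?v j \<noteq> 0" using act_simple_root_nonzero[OF x(1) i] .
  have jJ: "j \<in> J" using supp j by auto
  have "act (inv x) (simple_root j) t = 0" if "t \<noteq> i" for t
  proof (rule act_zero_coordinate[of "inv x" ?v e e t j])
    show "0 \<le> e * ?v j * (e * act (inv x) (simple_root j) t)" if "j \<in> support ?v" for j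
      using x(2)[OF assms(5), of j] x(3)[of j t] that supp by auto
  qed (use x(1) v j assms(2) that in \<open>auto simp: simple_root_def\<close>)
  then have "inv x \<otimes> j = i \<otimes> inv x"
    using simple_conjugate[of "inv x" j i] x(1) jJ assms(3) i by auto
  then have "x \<otimes> (inv x \<otimes> j) \<otimes> x = x \<otimes> (i \<otimes> inv x) \<otimes> x" by simp
  moreover have "j \<in> carrier W" "i \<in> carrier W" using jJ assms(3) i by auto
  ultimately have "x \<otimes> i = j \<otimes> x" using x(1) by (simp add: m_assoc[symmetric]) (simp add: m_assoc)
  with that jJ show thesis by blast
qed

text \<open>
  Induction on the length of \<open>c\<close>. If \<open>c\<close> has a descent \<open>i \<in> I\<close>, let \<open>\<beta> = - c \<alpha>\<^sub>i\<close>, a positive root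
  supported in \<open>I\<close>. The signs of \<open>x \<beta>\<close> and \<open>a x \<beta> = - y \<alpha>\<^sub>i\<close> are opposite, because both \<open>x\<close> and
  \<open>y\<close> are extremal, so \<open>x \<beta>\<close> is supported in \<open>J\<close>. The same then holds for \<open>x \<alpha>\<^sub>k\<close> for each \<open>k\<close> in the
  support of \<open>\<beta>\<close>. At least one such \<open>k\<close> is a left descent of \<open>c\<close>, because \<open>c\<^sup>-\<^sup>1 \<beta> = - \<alpha>\<^sub>i\<close>; moved
  across \<open>x\<close>, it becomes an element of \<open>J\<close> and shortens \<open>c\<close>.
\<close>

lemma extremal_left_coset:
  assumes x: "extremal e J I x" and y: "extremal e J I y" and e: "e \<noteq> 0" and JI: "J \<subseteq> S" "I \<subseteq> S"
    and "a \<in> parabolic J" "c \<in> parabolic I" "y = a \<otimes> x \<otimes> c"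
  obtains b where "b \<in> parabolic J" "y = b \<otimes> x"
proof -
  have "\<exists>b\<in>parabolic J. y = b \<otimes> x"
    using assms(6-8)
  proof (induction "len c" arbitrary: a c rule: less_induct)
    case less
    note a = less.prems(1) and c = less.prems(2)
    note xD = extremalD[OF x]
    have carr: "a \<in> carrier W" "c \<in> carrier W" "x \<in> carrier W"
      using a c JI xD(1) parabolic_closed(2) by auto
    show ?case
    proof (cases "c = \<one>")
      case True
      with less.prems carr show ?thesis by auto
    next
      case False
      obtain i where i: "i \<in> I" "\<forall>t. act c (simple_root i) t \<le> 0"
        using parabolic_descent[OF JI(2) c False] .
      have iS: "i \<in> S" using i JI by auto
      define \<beta> where "\<beta> = (\<lambda>t. - act c (simple_root i) t)"
      have \<beta>: "\<beta> \<in> root_space" "nonneg \<beta>"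
        using i(2) root_uminus[of "act c (simple_root i)"] carr iS by (auto simp: \<beta>_def)
      have \<beta>I: "support \<beta> \<subseteq> I"
        using parabolic_act_support[OF JI(2) c, of "simple_root i"] iS i(1)
        by (simp add: \<beta>_def support_simple_root)
      define \<delta> where "\<delta> = act x \<beta>"
      have \<delta>: "\<delta> \<in> root_space" using \<beta> carr by (simp add: \<delta>_def)
      have pos: "0 \<le> e * \<delta> t" for t
        unfolding \<delta>_def by (rule act_nonneg[OF carr(3) \<beta>(1) \<beta>I \<beta>(2) xD(2)])
      have "act y (simple_root i) = (\<lambda>t. - act a \<delta> t)"
        using less.prems(3) carr iS \<beta>
        by (simp add: act_mult \<delta>_def \<beta>_def act_uminus)
      then have neg: "e * act a \<delta> t \<le> 0" for t
        using extremalD(2)[OF y i(1), of t] by simp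
      have \<delta>J: "\<delta> t = 0" if "t \<notin> J" for t
        using pos[of t] neg[of t] parabolic_act_coordinate[OF JI(1) a \<delta> that] e by auto
      have "act (inv c) \<beta> = (\<lambda>t. - simple_root i t)"
        using carr iS by (simp add: \<beta>_def act_uminus)
      then have "\<not> nonneg (act (inv c) \<beta>)" by (auto intro!: exI[of _ i])
      then obtain k where k: "k \<in> support \<beta>" "\<not> nonneg (act (inv c) (simple_root k))"
        using act_nonneg[of "inv c" \<beta> "support \<beta>" 1] \<beta> carr by fastforce
      then have kI: "k \<in> I" "k \<in> S" using \<beta>I JI by auto
      have "len (inv c \<otimes> k) < len (inv c)"
        using k(2) nonneg_iff_ascent[of "inv c" k] len_mult_S_neq[of "inv c" k] carr kI by force
      then have shorter: "len (k \<otimes> c) < len c"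
        using carr kI len_inv[of "k \<otimes> c"] by (simp add: inv_mult_group len_inv)
      have "act x (simple_root k) t = 0" if "t \<notin> J" for t
      proof (rule act_zero_coordinate[of x \<beta> 1 e t k])
        show "act x \<beta> t = 0" using \<delta>J[OF that] by (simp add: \<delta>_def)
        show "0 \<le> 1 * \<beta> i * (e * act x (simple_root i) t)" if "i \<in> support \<beta>" for i
          using \<beta>(2) xD(2)[of i t] that \<beta>I by auto
      qed (use carr \<beta> k e in auto)
      then have "support (act x (simple_root k)) \<subseteq> J" by auto
      then obtain j where j: "j \<in> J" "x \<otimes> k = j \<otimes> x"
        using extremal_simple_conjugate[OF x e JI kI(1)] by blast
      have jS: "j \<in> S" using j JI by auto
      have "y = a \<otimes> (x \<otimes> k) \<otimes> (k \<otimes> c)"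
        using less.prems(3) carr kI by (simp add: m_assoc)
      then have "y = (a \<otimes> j) \<otimes> x \<otimes> (k \<otimes> c)"
        using carr jS by (simp add: j(2) m_assoc)
      moreover have "a \<otimes> j \<in> parabolic J" "k \<otimes> c \<in> parabolic I"
        using a c j(1) kI(1) JI parabolic_incl parabolic_closed(4) by blast+
      ultimately show ?thesis using less.hyps[OF shorter] by blast
    qed
  qed
  with that show thesis by blast
qed

text \<open>
  The previous lemma leaves \<open>y = b x\<close> with \<open>b \<in> W\<^sub>J\<close>. A descent \<open>j\<close> of \<open>b\<^sup>-\<^sup>1\<close> would give
  \<open>x\<^sup>-\<^sup>1 (b\<^sup>-\<^sup>1 \<alpha>\<^sub>j)\<close> the wrong sign.
\<close>

theorem extremal_unique:
  assumes x: "extremal e J I x" and y: "extremal e J I y" and e: "e \<noteq> 0" and JI: "J \<subseteq> S" "I \<subseteq> S"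
    and "a \<in> parabolic J" "c \<in> parabolic I" "y = a \<otimes> x \<otimes> c"
  shows "y = x"
proof -
  obtain b where b: "b \<in> parabolic J" "y = b \<otimes> x"
    using extremal_left_coset[OF assms] .
  have carr: "x \<in> carrier W" "b \<in> carrier W" using extremalD(1)[OF x] b JI parabolic_closed(2) by auto
  have "inv b = \<one>"
  proof (rule ccontr)
    assume neq: "inv b \<noteq> \<one>"
    obtain j where j: "j \<in> J" "\<forall>t. act (inv b) (simple_root j) t \<le> 0"
      using parabolic_descent[OF JI(1) _ neq] parabolic_closed(3)[OF JI(1) b(1)] by blast
    have jS: "j \<in> S" using j JI by auto
    define \<beta> where "\<beta> = (\<lambda>t. - act (inv b) (simple_root j) t)"
    have \<beta>: "\<beta> \<in> root_space" "nonneg \<beta>" "\<beta> \<in> roots"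
      using j(2) root_uminus[of "act (inv b) (simple_root j)"] carr jS by (auto simp: \<beta>_def)
    have \<beta>J: "support \<beta> \<subseteq> J"
      using parabolic_act_support[OF JI(1), of "inv b" "simple_root j"] parabolic_closed(3)[OF JI(1) b(1)]
        jS j(1) by (simp add: \<beta>_def support_simple_root)
    have pos: "0 \<le> e * act (inv x) \<beta> t" for t
      using act_nonneg[of "inv x" \<beta> J e t] extremalD(3)[OF x] \<beta> \<beta>J carr by blast
    have "act (inv y) (simple_root j) = (\<lambda>t. - act (inv x) \<beta> t)"
      using b carr jS by (simp add: \<beta>_def inv_mult_group act_mult act_uminus)
    then have neg: "e * act (inv x) \<beta> t \<le> 0" for t
      using extremalD(3)[OF y j(1), of t] by simp
    have zero: "act (inv x) \<beta> t = 0" for t using pos[of t] neg[of t] e by simp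
    obtain t where "act (inv x) \<beta> t \<noteq> 0" using root_nonzero[of "act (inv x) \<beta>"] \<beta>(3) carr by blast
    with zero show False by blast
  qed
  then have "b = \<one>" using carr by (metis inv_inv inv_one)
  then show ?thesis using b carr by simp
qed

text \<open>
  Making an element extremal on the right does not destroy extremality on the left. If
  \<open>\<delta> = (y z)\<^sup>-\<^sup>1 \<alpha>\<^sub>j\<close> had the opposite sign of \<open>y\<^sup>-\<^sup>1 \<alpha>\<^sub>j\<close>, it would be supported in \<open>I\<close>, because
  \<open>z\<^sup>-\<^sup>1\<close> changes only the coordinates there. Then extremality on the right determines the sign of
  \<open>(y z) \<delta> = \<alpha>\<^sub>j\<close>, and makes it negative.
\<close>

lemma extremal_extend:
  assumes y: "y \<in> carrier W" and z: "z \<in> parabolic I" and JI: "J \<subseteq> S" "I \<subseteq> S" and e: "e \<noteq> 0"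
    and left: "\<And>j t. j \<in> J \<Longrightarrow> 0 \<le> e * act (inv y) (simple_root j) t"
    and right: "\<And>i t. i \<in> I \<Longrightarrow> 0 \<le> e * act (y \<otimes> z) (simple_root i) t"
  shows "extremal e J I (y \<otimes> z)"
proof -
  have zc: "z \<in> carrier W" using parabolic_closed(2)[OF JI(2) z] .
  have "0 \<le> e * act (inv (y \<otimes> z)) (simple_root j) t" if j: "j \<in> J" for j t
  proof (rule ccontr)
    assume neg: "\<not> ?thesis"
    have jS: "j \<in> S" using j JI by auto
    define \<delta> where "\<delta> = act (inv (y \<otimes> z)) (simple_root j)"
    have \<delta>: "\<delta> \<in> roots" using y zc jS by (simp add: \<delta>_def)
    have neg': "\<not> 0 \<le> e * \<delta> t" using neg by (simp add: \<delta>_def)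
    have \<delta>_neg: "e * \<delta> u \<le> 0" for u
      using root_sign[OF \<delta>]
    proof
      assume pos: "nonneg \<delta>"
      with neg' have "e < 0" by (metis mult_nonneg_nonneg not_le)
      with pos show ?thesis by (simp add: mult_le_0_iff)
    next
      assume "\<forall>t. \<delta> t \<le> 0"
      moreover from this neg' have "e > 0" by (metis mult_nonpos_nonpos not_le)
      ultimately show ?thesis by (simp add: mult_le_0_iff)
    qed
    have "\<delta> = act (inv z) (act (inv y) (simple_root j))"
      using y zc jS by (simp add: \<delta>_def inv_mult_group act_mult)
    then have "\<delta> t = act (inv y) (simple_root j) t" if "t \<notin> I" for t
      using parabolic_act_coordinate[OF JI(2), of "inv z"] parabolic_closed(3)[OF JI(2) z] that y jS by auto
    then have \<delta>I: "\<delta> t = 0" if "t \<notin> I" for t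
      using left[OF j, of t] \<delta>_neg[of t] that e by (simp add: order.antisym)
    have "0 \<le> e * act (y \<otimes> z) (\<lambda>t. - e * \<delta> t) t" for t
    proof (rule act_nonneg[OF _ _ _ _ right])
      show "(\<lambda>t. - e * \<delta> t) \<in> root_space"
        using root_space_lin[of \<delta> \<delta> "- e" 0] \<delta> by auto
    qed (use y zc \<delta>I \<delta>_neg in auto)
    moreover have "act (y \<otimes> z) (\<lambda>t. - e * \<delta> t) = (\<lambda>t. - e * simple_root j t)"
      using act_scale[of "y \<otimes> z" \<delta> "- e"] \<delta> y zc jS by (simp add: \<delta>_def)
    ultimately have "0 \<le> e * (- e * simple_root j j)" by (metis (no_types))
    then show False using e by (auto simp: mult_le_0_iff)
  qed
  with y zc right show ?thesis by (simp add: extremal_def)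
qed

lemma double_coset_closed:
  assumes "p \<in> double_cosets J I" "J \<subseteq> S" "I \<subseteq> S" "y \<in> p"
  shows "y \<in> carrier W"
  using assms parabolic_closed(2)[of J] parabolic_closed(2)[of I]
  by (auto simp: double_cosets_def set_mult_def l_coset_def)

lemma inv_mult_cancel [simp]:
  assumes "x \<in> carrier W" "y \<in> carrier W"
  shows "inv x \<otimes> (x \<otimes> y) = y" "x \<otimes> (inv x \<otimes> y) = y"
  using assms by (simp_all flip: m_assoc)

lemma double_coset_iff:
  assumes p: "p \<in> double_cosets J I" and JI: "J \<subseteq> S" "I \<subseteq> S" and y: "y \<in> p"
  shows "z \<in> p \<longleftrightarrow> (\<exists>a\<in>parabolic J. \<exists>c\<in>parabolic I. z = a \<otimes> y \<otimes> c)"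
proof -
  note J = parabolic_closed[OF JI(1)] and I = parabolic_closed[OF JI(2)]
  obtain x where x: "x \<in> carrier W" "p = parabolic J <#> (x <# parabolic I)"
    using p by (auto simp: double_cosets_def)
  have mem: "z \<in> p \<longleftrightarrow> (\<exists>a\<in>parabolic J. \<exists>c\<in>parabolic I. z = a \<otimes> x \<otimes> c)" for z
    unfolding x(2) using x(1) J(2) I(2)
    by (fastforce simp: set_mult_def l_coset_def m_assoc)
  obtain a0 c0 where y0: "a0 \<in> parabolic J" "c0 \<in> parabolic I" "y = a0 \<otimes> x \<otimes> c0"
    using y mem by blast
  have carr: "a0 \<in> carrier W" "c0 \<in> carrier W" using y0 J I by auto
  show ?thesis
  proof
    assume "z \<in> p"
    then obtain a c where z: "a \<in> parabolic J" "c \<in> parabolic I" "z = a \<otimes> x \<otimes> c"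
      using mem by blast
    then have "z = (a \<otimes> inv a0) \<otimes> y \<otimes> (inv c0 \<otimes> c)"
      using y0(3) carr J(2)[OF z(1)] I(2)[OF z(2)] x(1) by (simp add: m_assoc)
    moreover have "a \<otimes> inv a0 \<in> parabolic J" "inv c0 \<otimes> c \<in> parabolic I"
      using J(3,4) I(3,4) z y0 by blast+
    ultimately show "\<exists>a\<in>parabolic J. \<exists>c\<in>parabolic I. z = a \<otimes> y \<otimes> c" by blast
  next
    assume "\<exists>a\<in>parabolic J. \<exists>c\<in>parabolic I. z = a \<otimes> y \<otimes> c"
    then obtain a c where z: "a \<in> parabolic J" "c \<in> parabolic I" "z = a \<otimes> y \<otimes> c"
      by blast
    then have "z = (a \<otimes> a0) \<otimes> x \<otimes> (c0 \<otimes> c)"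
      using y0(3) carr J(2)[OF z(1)] I(2)[OF z(2)] x(1) by (simp add: m_assoc)
    moreover have "a \<otimes> a0 \<in> parabolic J" "c0 \<otimes> c \<in> parabolic I"
      using J(4) I(4) z y0 by blast+
    ultimately show "z \<in> p" unfolding mem by blast
  qed
qed

lemma double_coset_nonempty: "p \<in> double_cosets J I \<Longrightarrow> J \<subseteq> S \<Longrightarrow> I \<subseteq> S \<Longrightarrow> \<exists>x. x \<in> p"
  using parabolic_closed(1)[of J] parabolic_closed(1)[of I]
  by (auto simp: double_cosets_def set_mult_def l_coset_def)

lemma double_coset_finite:
  assumes "p \<in> double_cosets J I" "finitary J" "finitary I"
  shows "finite p"
  using assms by (auto simp: double_cosets_def finitary_def set_mult_def l_coset_def)

lemma double_coset_mult:
  assumes p: "p \<in> double_cosets J I" and JI: "J \<subseteq> S" "I \<subseteq> S" and y: "y \<in> p"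
  shows "a \<in> parabolic J \<Longrightarrow> a \<otimes> y \<in> p" "c \<in> parabolic I \<Longrightarrow> y \<otimes> c \<in> p"
proof -
  have carr: "y \<in> carrier W" using double_coset_closed[OF p JI y] .
  note J = parabolic_closed[OF JI(1)] and I = parabolic_closed[OF JI(2)]
  show "a \<otimes> y \<in> p" if "a \<in> parabolic J"
    unfolding double_coset_iff[OF p JI y]
    using that carr J(2)[OF that] I(1) by (intro bexI[of _ a] bexI[of _ \<one>]) auto
  show "y \<otimes> c \<in> p" if "c \<in> parabolic I"
    unfolding double_coset_iff[OF p JI y]
    using that carr I(2)[OF that] J(1) by (intro bexI[of _ \<one>] bexI[of _ c]) auto
qed

lemma nonpos_iff_descent:
  assumes "x \<in> carrier W" "s \<in> S"
  shows "(\<forall>t. act x (simple_root s) t \<le> 0) \<longleftrightarrow> len (x \<otimes> s) < len x"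
proof
  assume le: "\<forall>t. act x (simple_root s) t \<le> 0"
  obtain t where "act x (simple_root s) t \<noteq> 0" using act_simple_root_nonzero[OF assms] .
  moreover have "act x (simple_root s) t \<le> 0" using le by blast
  ultimately have "\<not> 0 \<le> act x (simple_root s) t" by linarith
  then have "\<not> nonneg (act x (simple_root s))" by blast
  then have "\<not> len x < len (x \<otimes> s)" using nonneg_iff_ascent[OF assms] by blast
  with len_mult_S_neq[OF assms] show "len (x \<otimes> s) < len x" by linarith
qed (use descent_nonpos assms in blast)

lemma len_inv_mult_S: "x \<in> carrier W \<Longrightarrow> s \<in> S \<Longrightarrow> len (inv x \<otimes> s) = len (s \<otimes> x)"
  using len_inv[of "s \<otimes> x"] by (simp add: inv_mult_group)

lemma extremal_min_iff:
  assumes "x \<in> carrier W" "J \<subseteq> S" "I \<subseteq> S"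
  shows "extremal 1 J I x \<longleftrightarrow> (\<forall>i\<in>I. len x < len (x \<otimes> i)) \<and> (\<forall>j\<in>J. len x < len (j \<otimes> x))"
proof -
  have "(nonneg (act x (simple_root i))) \<longleftrightarrow> len x < len (x \<otimes> i)" if "i \<in> I" for i
    using nonneg_iff_ascent[of x i] assms that by blast
  moreover have "(nonneg (act (inv x) (simple_root j))) \<longleftrightarrow> len x < len (j \<otimes> x)" if "j \<in> J" for j
    using nonneg_iff_ascent[of "inv x" j] len_inv_mult_S[of x j] len_inv[of x] assms that by auto
  ultimately show ?thesis
    using assms(1) by (simp add: extremal_def cong: ball_cong)
qed

lemma extremal_max_iff:
  assumes "x \<in> carrier W" "J \<subseteq> S" "I \<subseteq> S"
  shows "extremal (- 1) J I x \<longleftrightarrow> (\<forall>i\<in>I. len (x \<otimes> i) < len x) \<and> (\<forall>j\<in>J. len (j \<otimes> x) < len x)"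
proof -
  have "(\<forall>t. act x (simple_root i) t \<le> 0) \<longleftrightarrow> len (x \<otimes> i) < len x" if "i \<in> I" for i
    using nonpos_iff_descent[of x i] assms that by blast
  moreover have "(\<forall>t. act (inv x) (simple_root j) t \<le> 0) \<longleftrightarrow> len (j \<otimes> x) < len x" if "j \<in> J" for j
    using nonpos_iff_descent[of "inv x" j] len_inv_mult_S[of x j] len_inv[of x] assms that by auto
  ultimately show ?thesis
    using assms(1) by (simp add: extremal_def cong: ball_cong)
qed

lemma len_S_mult_neq: "x \<in> carrier W \<Longrightarrow> s \<in> S \<Longrightarrow> len (s \<otimes> x) \<noteq> len x"
  using len_mult_S_neq[of "inv x" s] by (simp add: len_inv_mult_S len_inv)

lemma bruhat_le_len: "bruhat_le x y \<Longrightarrow> x = y \<or> len x < len y"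
  unfolding bruhat_le_def by (induction rule: rtranclp_induct) auto

lemma bruhat_le_right:
  assumes "x \<in> carrier W" "s \<in> S"
  shows "len x < len (x \<otimes> s) \<Longrightarrow> bruhat_le x (x \<otimes> s)"
    and "len (x \<otimes> s) < len x \<Longrightarrow> bruhat_le (x \<otimes> s) x"
proof -
  have s: "s \<in> reflections"
    unfolding reflections_def using assms(2)
    by (intro CollectI exI[of _ \<one>] exI[of _ s]) simp
  show "len x < len (x \<otimes> s) \<Longrightarrow> bruhat_le x (x \<otimes> s)"
    unfolding bruhat_le_def using s assms by (intro r_into_rtranclp) auto
  show "len (x \<otimes> s) < len x \<Longrightarrow> bruhat_le (x \<otimes> s) x"
    unfolding bruhat_le_def using s assms by (intro r_into_rtranclp) (auto intro!: bexI[of _ s])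
qed

text \<open>
  Left multiplication by \<open>s\<close> is right multiplication by the reflection \<open>x\<^sup>-\<^sup>1 s x\<close>.
\<close>

lemma bruhat_le_left:
  assumes "x \<in> carrier W" "s \<in> S"
  shows "len x < len (s \<otimes> x) \<Longrightarrow> bruhat_le x (s \<otimes> x)"
    and "len (s \<otimes> x) < len x \<Longrightarrow> bruhat_le (s \<otimes> x) x"
proof -
  have r: "inv y \<otimes> s \<otimes> y \<in> reflections" if "y \<in> carrier W" for y
    unfolding reflections_def using assms(2) that
    by (intro CollectI exI[of _ "inv y"] exI[of _ s]) simp
  have step: "s \<otimes> y = y \<otimes> (inv y \<otimes> s \<otimes> y)" if "y \<in> carrier W" for y
    using that assms(2) by (simp flip: m_assoc)
  have le: "bruhat_le y (s \<otimes> y)" if "y \<in> carrier W" "len y < len (s \<otimes> y)" for y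
    unfolding bruhat_le_def using that r[of y] step[of y] by (intro r_into_rtranclp) blast
  show "len x < len (s \<otimes> x) \<Longrightarrow> bruhat_le x (s \<otimes> x)" using le assms by blast
  show "len (s \<otimes> x) < len x \<Longrightarrow> bruhat_le (s \<otimes> x) x"
    using le[of "s \<otimes> x"] assms by simp
qed

lemma extremal_unique_in_coset:
  assumes "p \<in> double_cosets J I" "J \<subseteq> S" "I \<subseteq> S" "e \<noteq> 0"
    and "x \<in> p" "extremal e J I x" "y \<in> p" "extremal e J I y"
  shows "y = x"
proof -
  obtain a c where "a \<in> parabolic J" "c \<in> parabolic I" "y = a \<otimes> x \<otimes> c"
    using double_coset_iff[OF assms(1-3,5), of y] assms(7) by blast
  then show ?thesis using extremal_unique[OF assms(6,8,4,2,3)] by blast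
qed

text \<open>
  An element of least length is extremal, hence it is the only extremal element. A Bruhat-minimal
  element is extremal as well, since a descent would give a smaller element of the coset.
\<close>

theorem coset_min_characterization:
  assumes p: "p \<in> double_cosets J I" and JI: "J \<subseteq> S" "I \<subseteq> S"
  shows "coset_min p \<in> p" "extremal 1 J I (coset_min p)"
    and "x \<in> p \<Longrightarrow> extremal 1 J I x \<Longrightarrow> coset_min p = x"
proof -
  note carr = double_coset_closed[OF p JI]
  have mult: "j \<otimes> y \<in> p" if "y \<in> p" "j \<in> J" for j y
    using double_coset_mult(1)[OF p JI] that parabolic_incl by blast
  have mult': "y \<otimes> i \<in> p" if "y \<in> p" "i \<in> I" for i y
    using double_coset_mult(2)[OF p JI] that parabolic_incl by blast
  obtain x0 where x0: "x0 \<in> p" "\<And>y. y \<in> p \<Longrightarrow> len x0 \<le> len y"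
    using double_coset_nonempty[OF p JI] ex_has_least_nat[of "\<lambda>x. x \<in> p" _ len] by blast
  have x0_ext: "extremal 1 J I x0"
    unfolding extremal_min_iff[OF carr[OF x0(1)] JI]
  proof (intro conjI ballI)
    show "len x0 < len (x0 \<otimes> i)" if "i \<in> I" for i
      using x0(2)[OF mult'[OF x0(1) that]] len_mult_S_neq[OF carr[OF x0(1)], of i] that JI
      by (auto simp: order_less_le)
    show "len x0 < len (j \<otimes> x0)" if "j \<in> J" for j
      using x0(2)[OF mult[OF x0(1) that]] len_S_mult_neq[OF carr[OF x0(1)], of j] that JI
      by (auto simp: order_less_le)
  qed
  have iff: "x \<in> p \<and> (\<forall>y\<in>p. bruhat_le y x \<longrightarrow> y = x) \<longleftrightarrow> x = x0" for x
  proof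
    assume x: "x \<in> p \<and> (\<forall>y\<in>p. bruhat_le y x \<longrightarrow> y = x)"
    have "extremal 1 J I x"
      unfolding extremal_min_iff[OF carr JI, OF conjunct1[OF x]]
    proof (intro conjI ballI)
      fix i assume i: "i \<in> I"
      have "x \<otimes> i \<in> p" "x \<in> carrier W" "i \<in> S" using x i mult' carr JI by auto
      with x bruhat_le_right(2)[of x i] len_mult_S_neq[of x i] show "len x < len (x \<otimes> i)"
        by (metis linorder_neqE_nat)
    next
      fix j assume j: "j \<in> J"
      have "j \<otimes> x \<in> p" "x \<in> carrier W" "j \<in> S" using x j mult carr JI by auto
      with x bruhat_le_left(2)[of x j] len_S_mult_neq[of x j] show "len x < len (j \<otimes> x)"
        by (metis linorder_neqE_nat)
    qed
    with extremal_unique_in_coset[OF p JI _ x0(1) x0_ext, of x] x show "x = x0" by simp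
  next
    assume "x = x0"
    then show "x \<in> p \<and> (\<forall>y\<in>p. bruhat_le y x \<longrightarrow> y = x)"
      using x0 bruhat_le_len by (metis not_le)
  qed
  have min: "coset_min p = x0" unfolding coset_min_def iff by simp
  show "coset_min p \<in> p" "extremal 1 J I (coset_min p)" using min x0 x0_ext by auto
  show "coset_min p = x" if "x \<in> p" "extremal 1 J I x"
    using extremal_unique_in_coset[OF p JI _ that x0(1) x0_ext] min by simp
qed

text \<open>
  Dual to the minimal case. Finiteness of the coset provides an element of greatest length.
\<close>

theorem coset_max_characterization:
  assumes p: "p \<in> double_cosets J I" and fin: "finitary J" "finitary I"
  shows "coset_max p \<in> p" "extremal (- 1) J I (coset_max p)"
    and "x \<in> p \<Longrightarrow> extremal (- 1) J I x \<Longrightarrow> coset_max p = x"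
proof -
  have JI: "J \<subseteq> S" "I \<subseteq> S" using fin by (auto simp: finitary_def)
  note carr = double_coset_closed[OF p JI]
  have mult: "j \<otimes> y \<in> p" if "y \<in> p" "j \<in> J" for j y
    using double_coset_mult(1)[OF p JI] that parabolic_incl by blast
  have mult': "y \<otimes> i \<in> p" if "y \<in> p" "i \<in> I" for i y
    using double_coset_mult(2)[OF p JI] that parabolic_incl by blast
  have "finite (len ` p)" "len ` p \<noteq> {}"
    using double_coset_finite[OF p fin] double_coset_nonempty[OF p JI] by auto
  then have "Max (len ` p) \<in> len ` p" "\<And>y. y \<in> p \<Longrightarrow> len y \<le> Max (len ` p)" by auto
  then obtain x0 where x0: "x0 \<in> p" "\<And>y. y \<in> p \<Longrightarrow> len y \<le> len x0" by auto
  have x0_ext: "extremal (- 1) J I x0"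
    unfolding extremal_max_iff[OF carr[OF x0(1)] JI]
  proof (intro conjI ballI)
    show "len (x0 \<otimes> i) < len x0" if "i \<in> I" for i
      using x0(2)[OF mult'[OF x0(1) that]] len_mult_S_neq[OF carr[OF x0(1)], of i] that JI
      by (auto simp: order_less_le)
    show "len (j \<otimes> x0) < len x0" if "j \<in> J" for j
      using x0(2)[OF mult[OF x0(1) that]] len_S_mult_neq[OF carr[OF x0(1)], of j] that JI
      by (auto simp: order_less_le)
  qed
  have iff: "x \<in> p \<and> (\<forall>y\<in>p. bruhat_le x y \<longrightarrow> y = x) \<longleftrightarrow> x = x0" for x
  proof
    assume x: "x \<in> p \<and> (\<forall>y\<in>p. bruhat_le x y \<longrightarrow> y = x)"
    have "extremal (- 1) J I x"
      unfolding extremal_max_iff[OF carr JI, OF conjunct1[OF x]]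
    proof (intro conjI ballI)
      fix i assume i: "i \<in> I"
      have "x \<otimes> i \<in> p" "x \<in> carrier W" "i \<in> S" using x i mult' carr JI by auto
      with x bruhat_le_right(1)[of x i] len_mult_S_neq[of x i] show "len (x \<otimes> i) < len x"
        by (metis linorder_neqE_nat)
    next
      fix j assume j: "j \<in> J"
      have "j \<otimes> x \<in> p" "x \<in> carrier W" "j \<in> S" using x j mult carr JI by auto
      with x bruhat_le_left(1)[of x j] len_S_mult_neq[of x j] show "len (j \<otimes> x) < len x"
        by (metis linorder_neqE_nat)
    qed
    with extremal_unique_in_coset[OF p JI _ x0(1) x0_ext, of x] x show "x = x0" by simp
  next
    assume "x = x0"
    then show "x \<in> p \<and> (\<forall>y\<in>p. bruhat_le x y \<longrightarrow> y = x)"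
      using x0 bruhat_le_len by (metis not_le)
  qed
  have max: "coset_max p = x0" unfolding coset_max_def iff by simp
  show "coset_max p \<in> p" "extremal (- 1) J I (coset_max p)" using max x0 x0_ext by auto
  show "coset_max p = x" if "x \<in> p" "extremal (- 1) J I x"
    using extremal_unique_in_coset[OF p JI _ that x0(1) x0_ext] max by simp
qed

section \<open>Facets and hyperplanes\<close>

lemma pairing_superset:
  assumes "finite A" "support v \<subseteq> A"
  shows "pairing l v = (\<Sum>t\<in>A. l t * v t)"
  unfolding pairing_def using assms by (intro sum.mono_neutral_left) auto

lemma pairing_uminus: "pairing l (\<lambda>t. - v t) = - pairing l v"
  by (simp add: pairing_def sum_negf)

lemma pairing_dual_act:
  assumes x: "x \<in> carrier W" and b: "b \<in> root_space"
  shows "pairing (dual_act x l) b = pairing l (act (inv x) b)"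
proof -
  let ?A = "support b"
  have A: "finite ?A" "?A \<subseteq> S" using b by (auto simp: root_space_def)
  define B where "B = (\<Union>t\<in>?A. support (act (inv x) (simple_root t))) \<union> support (act (inv x) b)"
  have fin: "finite (support (act (inv x) v))" if "v \<in> root_space" for v
    using x that by (intro root_space_finite) auto
  then have B: "finite B" using A b unfolding B_def by auto
  have "pairing (dual_act x l) b = (\<Sum>t\<in>?A. pairing l (act (inv x) (simple_root t)) * b t)"
    unfolding pairing_def[of "dual_act x l"] using A(2)
    by (intro sum.cong) (auto simp: dual_act_def)
  also have "\<dots> = (\<Sum>t\<in>?A. \<Sum>u\<in>B. l u * act (inv x) (simple_root t) u * b t)"
  proof (rule sum.cong[OF HOL.refl])
    fix t assume "t \<in> ?A"
    then have "support (act (inv x) (simple_root t)) \<subseteq> B" by (auto simp: B_def)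
    with pairing_superset[OF B] show "pairing l (act (inv x) (simple_root t)) * b t =
        (\<Sum>u\<in>B. l u * act (inv x) (simple_root t) u * b t)"
      by (simp add: sum_distrib_right)
  qed
  also have "\<dots> = (\<Sum>u\<in>B. l u * (\<Sum>t\<in>?A. b t * act (inv x) (simple_root t) u))"
    by (subst sum.swap) (simp add: sum_distrib_left mult_ac)
  also have "\<dots> = (\<Sum>u\<in>B. l u * act (inv x) b u)"
    using act_expand[OF _ b A(1) _ A(2)] x by simp
  also have "\<dots> = pairing l (act (inv x) b)"
    using B by (intro pairing_superset[symmetric]) (auto simp: B_def)
  finally show ?thesis .
qed

text \<open>
  The functional is zero on \<open>I\<close> and positive on the other simple roots, and all coefficients of a root
  have the same sign, so nothing cancels.
\<close>

lemma sgn_pairing_root: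
  assumes l: "l \<in> dominant_facet I" and \<gamma>: "\<gamma> \<in> roots"
  shows "sgn (pairing l \<gamma>) = (if support \<gamma> \<subseteq> I then 0 else if nonneg \<gamma> then 1 else - 1)"
proof -
  have S: "support v \<subseteq> S" "finite (support v)" if "v \<in> roots" for v
    using root_in_space[OF that] by (auto simp: root_space_def)
  have lt: "0 < l t" if "t \<in> S" "t \<notin> I" for t using l that by (auto simp: dominant_facet_def)
  have l0: "l t = 0" if "t \<in> S" "t \<in> I" for t using l that by (auto simp: dominant_facet_def)
  have pos: "pairing l v > 0" if v: "v \<in> roots" "nonneg v" "\<not> support v \<subseteq> I" for v
  proof -
    obtain t where t: "t \<in> support v" "t \<notin> I" using v by blast
    have le: "0 \<le> l u" if "u \<in> support v" for u
      using lt[of u] l0[of u] S(1)[OF v(1)] that by (cases "u \<in> I") (auto simp: order_less_imp_le)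
    have "0 < l t * v t"
      using lt[of t] t S(1)[OF v(1)] v(2) by (auto simp: order_less_le)
    then show ?thesis
      unfolding pairing_def using t le v(2) S(2)[OF v(1)]
      by (intro sum_pos2[of _ t]) auto
  qed
  show ?thesis
  proof (cases "support \<gamma> \<subseteq> I")
    case True
    then have "pairing l \<gamma> = 0"
      unfolding pairing_def using S(1)[OF \<gamma>] l0 by (intro sum.neutral) auto
    with True show ?thesis by simp
  next
    case False
    show ?thesis
    proof (cases "nonneg \<gamma>")
      case True
      with pos[OF \<gamma> True False] False show ?thesis by simp
    next
      case neg: False
      then have "nonneg (\<lambda>t. - \<gamma> t)" using root_sign[OF \<gamma>] by auto
      with pos[OF root_uminus[OF \<gamma>]] False have "pairing l \<gamma> < 0"
        by (simp add: pairing_uminus)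
      with False neg show ?thesis by auto
    qed
  qed
qed

lemma dominant_facet_nonempty: "(\<lambda>t. if t \<in> S - I then 1 else 0) \<in> dominant_facet I"
  by (auto simp: dominant_facet_def dual_space_def)

lemma dual_act_in: "dual_act x l \<in> dual_space"
  by (simp add: dual_act_def dual_space_def)

lemma facet_hyperplane_iff:
  assumes x: "x \<in> carrier W" and b: "b \<in> roots"
  shows "dual_act x ` dominant_facet I \<subseteq> hyperplane b \<longleftrightarrow> support (act (inv x) b) \<subseteq> I"
proof -
  have g: "act (inv x) b \<in> roots" using x b by simp
  have "dual_act x ` dominant_facet I \<subseteq> hyperplane b \<longleftrightarrow>
    (\<forall>l\<in>dominant_facet I. sgn (pairing l (act (inv x) b)) = 0)"
    using x b by (auto simp: hyperplane_def dual_act_in pairing_dual_act sgn_zero_iff)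
  also have "\<dots> \<longleftrightarrow> support (act (inv x) b) \<subseteq> I"
    using dominant_facet_nonempty[of I] sgn_pairing_root[OF _ g, of _ I]
    by (auto split: if_splits)
  finally show ?thesis .
qed

text \<open>
  The sign of a functional in the dominant chamber on \<open>b\<close> is the sign of \<open>b\<close>, so the product that
  defines the half spaces compares the signs of \<open>x\<^sup>-\<^sup>1 b\<close> and \<open>b\<close>.
\<close>

lemma facet_half_space_iff:
  assumes x: "x \<in> carrier W" and b: "b \<in> roots"
  shows "dual_act x ` dominant_facet I \<subseteq> half_plus b \<longleftrightarrow>
      \<not> support (act (inv x) b) \<subseteq> I \<and> nonneg (act (inv x) b) \<noteq> nonneg b"
    and "dual_act x ` dominant_facet I \<subseteq> half_minus b \<longleftrightarrow>
      \<not> support (act (inv x) b) \<subseteq> I \<and> nonneg (act (inv x) b) = nonneg b"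
proof -
  have g: "act (inv x) b \<in> roots" using x b by simp
  define \<sigma> where "\<sigma> = (if support (act (inv x) b) \<subseteq> I then 0
    else if nonneg (act (inv x) b) = nonneg b then 1 else - 1 :: real)"
  have "\<not> support b \<subseteq> {}" using root_nonzero[OF b] by blast
  then have sgn: "sgn (pairing (dual_act x l) b * pairing c b) = \<sigma>"
    if "l \<in> dominant_facet I" "c \<in> dominant_chamber" for l c
    using sgn_pairing_root[OF that(1) g] sgn_pairing_root[OF that(2) b] x b
    by (auto simp: pairing_dual_act sgn_mult \<sigma>_def)
  have neg: "a < 0 \<longleftrightarrow> sgn a = - 1" and pos: "a > 0 \<longleftrightarrow> sgn a = 1" for a :: real
    by (auto simp: sgn_if)
  obtain l c where "l \<in> dominant_facet I" "c \<in> dominant_chamber"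
    using dominant_facet_nonempty by blast
  then have all: "(\<forall>l\<in>dominant_facet I. \<forall>c\<in>dominant_chamber.
      sgn (pairing (dual_act x l) b * pairing c b) = k) \<longleftrightarrow> \<sigma> = k" for k
    using sgn by auto
  have "dual_act x ` dominant_facet I \<subseteq> half_plus b \<longleftrightarrow> \<sigma> = - 1"
    unfolding all[symmetric] half_plus_def neg image_subset_iff by (simp add: dual_act_in)
  then show "dual_act x ` dominant_facet I \<subseteq> half_plus b \<longleftrightarrow>
      \<not> support (act (inv x) b) \<subseteq> I \<and> nonneg (act (inv x) b) \<noteq> nonneg b"
    by (simp add: \<sigma>_def)
  have "dual_act x ` dominant_facet I \<subseteq> half_minus b \<longleftrightarrow> \<sigma> = 1"
    unfolding all[symmetric] half_minus_def pos image_subset_iff by (simp add: dual_act_in)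
  then show "dual_act x ` dominant_facet I \<subseteq> half_minus b \<longleftrightarrow>
      \<not> support (act (inv x) b) \<subseteq> I \<and> nonneg (act (inv x) b) = nonneg b"
    by (simp add: \<sigma>_def)
qed

section \<open>Reduced steps and the sign of roots\<close>

lemma right_coset_min:
  assumes y: "y \<in> carrier W" and I: "I \<subseteq> S"
  obtains z where "z \<in> parabolic I" "\<And>i. i \<in> I \<Longrightarrow> nonneg (act (y \<otimes> z) (simple_root i))"
proof -
  obtain z where z: "z \<in> parabolic I" "\<And>z'. z' \<in> parabolic I \<Longrightarrow> len (y \<otimes> z) \<le> len (y \<otimes> z')"
    using ex_has_least_nat[of "\<lambda>z. z \<in> parabolic I" _ "\<lambda>z. len (y \<otimes> z)"] parabolic_closed(1)[OF I]
    by blast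
  have zc: "z \<in> carrier W" using parabolic_closed(2)[OF I z(1)] .
  have "nonneg (act (y \<otimes> z) (simple_root i))" if i: "i \<in> I" for i
  proof -
    have iS: "i \<in> S" using i I by blast
    have "z \<otimes> i \<in> parabolic I" using parabolic_closed(4)[OF I z(1) parabolic_incl[OF i]] .
    from z(2)[OF this] have "len (y \<otimes> z) \<le> len (y \<otimes> z \<otimes> i)" using y zc iS by (simp add: m_assoc)
    then show ?thesis
      using nonneg_iff_ascent[of "y \<otimes> z" i] len_mult_S_neq[of "y \<otimes> z" i] y zc iS by simp
  qed
  with z(1) that show thesis by blast
qed

lemma right_coset_max:
  assumes y: "y \<in> carrier W" and I: "finitary I"
  obtains z where "z \<in> parabolic I" "\<And>i t. i \<in> I \<Longrightarrow> act (y \<otimes> z) (simple_root i) t \<le> 0"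
proof -
  have IS: "I \<subseteq> S" and "finite (parabolic I)" using I by (auto simp: finitary_def)
  let ?L = "(\<lambda>z. len (y \<otimes> z)) ` parabolic I"
  have "finite ?L" "?L \<noteq> {}" using \<open>finite (parabolic I)\<close> parabolic_closed(1)[OF IS] by auto
  then have "Max ?L \<in> ?L" "\<And>z. z \<in> parabolic I \<Longrightarrow> len (y \<otimes> z) \<le> Max ?L" by auto
  then obtain z where z: "z \<in> parabolic I" "\<And>z'. z' \<in> parabolic I \<Longrightarrow> len (y \<otimes> z') \<le> len (y \<otimes> z)"
    by auto
  have zc: "z \<in> carrier W" using parabolic_closed(2)[OF IS z(1)] .
  have "act (y \<otimes> z) (simple_root i) t \<le> 0" if i: "i \<in> I" for i t
  proof -
    have iS: "i \<in> S" using i IS by blast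
    have "z \<otimes> i \<in> parabolic I" using parabolic_closed(4)[OF IS z(1) parabolic_incl[OF i]] .
    from z(2)[OF this] have "len (y \<otimes> z \<otimes> i) \<le> len (y \<otimes> z)" using y zc iS by (simp add: m_assoc)
    then have "len (y \<otimes> z \<otimes> i) < len (y \<otimes> z)"
      using len_mult_S_neq[of "y \<otimes> z" i] y zc iS by simp
    then show ?thesis using descent_nonpos[of "y \<otimes> z" i t] y zc iS by simp
  qed
  with z(1) that show thesis by blast
qed

text \<open>
  Shorten \<open>u\<close> from the left as far as possible. The result stays minimal on the right by
  \<open>extremal_extend\<close>, applied to inverses.
\<close>

lemma coset_min_left_coset:
  assumes p: "p \<in> double_cosets J I" and JI: "J \<subseteq> S" "I \<subseteq> S" and u: "u \<in> p"
    and pos: "\<And>i. i \<in> I \<Longrightarrow> nonneg (act u (simple_root i))"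
  obtains a where "a \<in> parabolic J" "u = a \<otimes> coset_min p"
proof -
  have uc: "u \<in> carrier W" using double_coset_closed[OF p JI u] .
  obtain a where a: "a \<in> parabolic J" "\<And>j. j \<in> J \<Longrightarrow> nonneg (act (inv u \<otimes> a) (simple_root j))"
    using right_coset_min[of "inv u" J] uc JI(1) by blast
  have ac: "a \<in> carrier W" using parabolic_closed(2)[OF JI(1) a(1)] .
  have "extremal 1 I J (inv u \<otimes> a)"
    using extremal_extend[of "inv u" a J I 1] a pos uc JI by simp
  moreover have "inv (inv u \<otimes> a) = inv a \<otimes> u" using uc ac by (simp add: inv_mult_group)
  ultimately have "extremal 1 J I (inv a \<otimes> u)"
    using uc ac unfolding extremal_def by (metis inv_inv m_closed inv_closed)
  then have "coset_min p = inv a \<otimes> u"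
    using coset_min_characterization(3)[OF p JI]
      double_coset_mult(1)[OF p JI u] parabolic_closed(3)[OF JI(1) a(1)] by blast
  then have "u = a \<otimes> coset_min p" using uc ac by simp
  with a(1) that show thesis by blast
qed

text \<open>
  Lengthen the maximal element of \<open>p\<close> from the right. It remains maximal on the left by
  \<open>extremal_extend\<close>.
\<close>

lemma coset_max_right_coset:
  assumes p: "p \<in> double_cosets J I" and q: "q \<in> double_cosets J I'" and pq: "p \<subseteq> q"
    and fin: "finitary J" "finitary I" "finitary I'"
  obtains z where "z \<in> parabolic I'" "coset_max q = coset_max p \<otimes> z"
proof -
  have sub: "J \<subseteq> S" "I' \<subseteq> S" using fin by (auto simp: finitary_def)
  let ?v = "coset_max p"
  note v = coset_max_characterization(1,2)[OF p fin(1,2)]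
  have vq: "?v \<in> q" using v(1) pq by blast
  note vc = double_coset_closed[OF q sub vq]
  obtain z where z: "z \<in> parabolic I'" "\<And>i t. i \<in> I' \<Longrightarrow> act (?v \<otimes> z) (simple_root i) t \<le> 0"
    using right_coset_max[OF vc fin(3)] by blast
  have "extremal (- 1) J I' (?v \<otimes> z)"
    using extremal_extend[OF vc z(1) sub, of "- 1"] z(2) extremalD(3)[OF v(2)] by simp
  then have "coset_max q = ?v \<otimes> z"
    using coset_max_characterization(3)[OF q fin(1,3)] double_coset_mult(2)[OF q sub vq z(1)] by blast
  with z(1) that show thesis by blast
qed

text \<open>
  The substitution \<open>\<gamma> = v\<^sup>-\<^sup>1 b\<close> permutes the roots. Elements of \<open>W\<^sub>I\<^sub>'\<close> preserve support in \<open>I'\<close>, so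
  \<open>w\<close> can be replaced by \<open>v\<close> in the condition on the larger facet.
\<close>

lemma root_sign_condition:
  assumes v: "v \<in> carrier W" and w: "w = v \<otimes> z" "z \<in> parabolic I'" and I': "I' \<subseteq> S"
  shows "(\<forall>b\<in>roots. dual_act w ` dominant_facet I' \<subseteq> hyperplane b \<longrightarrow>
        \<not> dual_act v ` dominant_facet I \<subseteq> half_plus b) \<longleftrightarrow>
      (\<forall>\<gamma>\<in>roots. support \<gamma> \<subseteq> I' \<longrightarrow> \<not> support \<gamma> \<subseteq> I \<longrightarrow> nonneg (act v \<gamma>) = nonneg \<gamma>)"
    and "(\<forall>b\<in>roots. dual_act w ` dominant_facet I' \<subseteq> hyperplane b \<longrightarrow>
        \<not> dual_act v ` dominant_facet I \<subseteq> half_minus b) \<longleftrightarrow>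
      (\<forall>\<gamma>\<in>roots. support \<gamma> \<subseteq> I' \<longrightarrow> \<not> support \<gamma> \<subseteq> I \<longrightarrow> nonneg (act v \<gamma>) \<noteq> nonneg \<gamma>)"
proof -
  have zc: "z \<in> carrier W" using parabolic_closed(2)[OF I' w(2)] .
  have wc: "w \<in> carrier W" using w(1) v zc by simp
  have supp: "support (act (inv w) b) \<subseteq> I' \<longleftrightarrow> support (act (inv v) b) \<subseteq> I'" if b: "b \<in> roots" for b
  proof -
    have w_v: "act (inv w) b = act (inv z) (act (inv v) b)"
      and v_w: "act (inv v) b = act z (act (inv w) b)"
      using b v zc by (simp_all add: w(1) inv_mult_group act_mult)
    show ?thesis
    proof
      show "support (act (inv v) b) \<subseteq> I'" if "support (act (inv w) b) \<subseteq> I'"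
        unfolding v_w by (rule parabolic_act_support[OF I' w(2) _ that]) (use b wc in simp)
      show "support (act (inv w) b) \<subseteq> I'" if "support (act (inv v) b) \<subseteq> I'"
        unfolding w_v
        by (rule parabolic_act_support[OF I' parabolic_closed(3)[OF I' w(2)] _ that]) (use b v in simp)
    qed
  qed
  have subst: "(\<forall>b\<in>roots. P (act (inv v) b) b) \<longleftrightarrow> (\<forall>\<gamma>\<in>roots. P \<gamma> (act v \<gamma>))" for P
  proof (intro iffI ballI)
    show "P \<gamma> (act v \<gamma>)" if "\<forall>b\<in>roots. P (act (inv v) b) b" "\<gamma> \<in> roots" for \<gamma>
      using that v bspec[OF that(1), of "act v \<gamma>"] by simp
    show "P (act (inv v) b) b" if "\<forall>\<gamma>\<in>roots. P \<gamma> (act v \<gamma>)" "b \<in> roots" for b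
      using that v bspec[OF that(1), of "act (inv v) b"] by simp
  qed
  note iffs = facet_hyperplane_iff[OF wc] facet_half_space_iff[OF v] supp
  have "(\<forall>b\<in>roots. dual_act w ` dominant_facet I' \<subseteq> hyperplane b \<longrightarrow>
        \<not> dual_act v ` dominant_facet I \<subseteq> half_plus b) \<longleftrightarrow>
      (\<forall>b\<in>roots. support (act (inv v) b) \<subseteq> I' \<longrightarrow> \<not> support (act (inv v) b) \<subseteq> I \<longrightarrow>
        nonneg b = nonneg (act (inv v) b))"
    by (rule ball_cong[OF HOL.refl]) (simp only: iffs, blast)
  then show "(\<forall>b\<in>roots. dual_act w ` dominant_facet I' \<subseteq> hyperplane b \<longrightarrow>
        \<not> dual_act v ` dominant_facet I \<subseteq> half_plus b) \<longleftrightarrow>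
      (\<forall>\<gamma>\<in>roots. support \<gamma> \<subseteq> I' \<longrightarrow> \<not> support \<gamma> \<subseteq> I \<longrightarrow> nonneg (act v \<gamma>) = nonneg \<gamma>)"
    unfolding subst[of "\<lambda>\<gamma> b. support \<gamma> \<subseteq> I' \<longrightarrow> \<not> support \<gamma> \<subseteq> I \<longrightarrow> nonneg b = nonneg \<gamma>"] .
  have "(\<forall>b\<in>roots. dual_act w ` dominant_facet I' \<subseteq> hyperplane b \<longrightarrow>
        \<not> dual_act v ` dominant_facet I \<subseteq> half_minus b) \<longleftrightarrow>
      (\<forall>b\<in>roots. support (act (inv v) b) \<subseteq> I' \<longrightarrow> \<not> support (act (inv v) b) \<subseteq> I \<longrightarrow>
        nonneg b \<noteq> nonneg (act (inv v) b))"
    by (rule ball_cong[OF HOL.refl]) (simp only: iffs, blast)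
  then show "(\<forall>b\<in>roots. dual_act w ` dominant_facet I' \<subseteq> hyperplane b \<longrightarrow>
        \<not> dual_act v ` dominant_facet I \<subseteq> half_minus b) \<longleftrightarrow>
      (\<forall>\<gamma>\<in>roots. support \<gamma> \<subseteq> I' \<longrightarrow> \<not> support \<gamma> \<subseteq> I \<longrightarrow> nonneg (act v \<gamma>) \<noteq> nonneg \<gamma>)"
    unfolding subst[of "\<lambda>\<gamma> b. support \<gamma> \<subseteq> I' \<longrightarrow> \<not> support \<gamma> \<subseteq> I \<longrightarrow> nonneg b \<noteq> nonneg \<gamma>"] .
qed

text \<open>
  If \<open>v\<close> is maximal in \<open>q\<close>, it makes the simple roots in \<open>I \<union> {s}\<close> negative, hence reverses all roots
  supported there. Conversely the simple root of \<open>s\<close> is one of the roots in the condition, and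
  reversing it is what \<open>v\<close> lacks to be maximal in \<open>q\<close>.
\<close>

lemma reduced_down_iff_signs:
  assumes p: "p \<in> double_cosets J I" and q: "q \<in> double_cosets J (insert s I)" and pq: "p \<subseteq> q"
    and fin: "finitary J" "finitary I" "finitary (insert s I)" and s: "s \<notin> I"
  defines "v \<equiv> coset_max p"
  shows "reduced_down q p \<longleftrightarrow> (\<forall>\<gamma>\<in>roots. support \<gamma> \<subseteq> insert s I \<longrightarrow> \<not> support \<gamma> \<subseteq> I \<longrightarrow>
    nonneg (act v \<gamma>) \<noteq> nonneg \<gamma>)"
proof
  note pv = coset_max_characterization(1,2)[OF p fin(1,2), folded v_def]
  have vc: "v \<in> carrier W" using extremalD(1)[OF pv(2)] .
  {
    assume "reduced_down q p"
    then have ext: "extremal (- 1) J (insert s I) v"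
      using coset_max_characterization(2)[OF q fin(1,3)] by (simp add: reduced_down_def v_def)
    have flip: "\<not> nonneg (act v \<gamma>)" if \<gamma>: "\<gamma> \<in> roots" "support \<gamma> \<subseteq> insert s I" "nonneg \<gamma>" for \<gamma>
    proof -
      have "0 \<le> - 1 * act v \<gamma> t" for t
        using act_nonneg[OF vc root_in_space[OF \<gamma>(1)] \<gamma>(2,3), of "- 1"] extremalD(2)[OF ext] by blast
      then have "nonneg (\<lambda>t. - act v \<gamma> t)" by simp
      then show ?thesis using nonneg_uminus_root[OF act_roots[OF \<gamma>(1) vc]] by blast
    qed
    show "\<forall>\<gamma>\<in>roots. support \<gamma> \<subseteq> insert s I \<longrightarrow> \<not> support \<gamma> \<subseteq> I \<longrightarrow> nonneg (act v \<gamma>) \<noteq> nonneg \<gamma>"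
    proof (intro ballI impI)
      fix \<gamma> assume \<gamma>: "\<gamma> \<in> roots" "support \<gamma> \<subseteq> insert s I"
      show "nonneg (act v \<gamma>) \<noteq> nonneg \<gamma>"
      proof (cases "nonneg \<gamma>")
        case True
        with flip[OF \<gamma>] show ?thesis by blast
      next
        case False
        have "support (\<lambda>t. - \<gamma> t) \<subseteq> insert s I" using \<gamma>(2) by simp
        with False flip[OF root_uminus[OF \<gamma>(1)]] have "\<not> nonneg (\<lambda>t. - act v \<gamma> t)"
          using nonneg_uminus_root[OF \<gamma>(1)] act_uminus[OF vc root_in_space[OF \<gamma>(1)]] by simp
        with False show ?thesis using nonneg_uminus_root[OF act_roots[OF \<gamma>(1) vc]] by blast
      qed
    qed
  next
    assume cond: "\<forall>\<gamma>\<in>roots. support \<gamma> \<subseteq> insert s I \<longrightarrow> \<not> support \<gamma> \<subseteq> I \<longrightarrow>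
      nonneg (act v \<gamma>) \<noteq> nonneg \<gamma>"
    have sS: "s \<in> S" using fin(3) by (simp add: finitary_def)
    have "nonneg (simple_root s)" by (simp add: simple_root_def)
    then have "\<not> nonneg (act v (simple_root s))"
      using bspec[OF cond simple_root_roots[OF sS]] s by (simp add: support_simple_root)
    then have "\<forall>t. act v (simple_root s) t \<le> 0"
      using root_sign[OF act_roots[OF simple_root_roots[OF sS] vc]] by blast
    then have "extremal (- 1) J (insert s I) v"
      using pv(2) by (simp add: extremal_def)
    then have "coset_max q = v"
      using coset_max_characterization(3)[OF q fin(1,3)] pv(1) pq by blast
    then show "reduced_down q p" by (simp add: reduced_down_def v_def)
  }
qed

text \<open>
  Write \<open>u = a x\<close> with \<open>a \<in> W\<^sub>J\<close> and \<open>x\<close> minimal in \<open>p\<close>, and let \<open>g = x \<alpha>\<^sub>s\<close>. If \<open>[p,q]\<close> is reduced,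
  \<open>g\<close> is positive and has a coordinate outside \<open>J\<close>, which \<open>a\<close> does not change. Conversely, suppose
  \<open>a g > 0\<close>. If \<open>g\<close> were negative, it would be supported in \<open>J\<close>, where \<open>x\<^sup>-\<^sup>1\<close> preserves signs, against
  \<open>x\<^sup>-\<^sup>1 g = \<alpha>\<^sub>s\<close>. If \<open>x s x\<^sup>-\<^sup>1\<close> were in \<open>J\<close>, then \<open>a g\<close> would be supported in \<open>J\<close>, where
  \<open>v\<^sup>-\<^sup>1\<close> reverses signs; but \<open>v\<^sup>-\<^sup>1 a g = z \<alpha>\<^sub>s\<close> has coordinate \<open>1\<close> at \<open>s\<close>.
\<close>

lemma reduced_up_iff_ascent:
  assumes p: "p \<in> double_cosets J I" and q: "q \<in> double_cosets J (insert s I)" and pq: "p \<subseteq> q"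
    and fin: "finitary J" "finitary I" "finitary (insert s I)" and s: "s \<notin> I"
    and z: "z \<in> parabolic I" and u: "u = coset_max p \<otimes> z"
    and u_min: "\<And>i. i \<in> I \<Longrightarrow> nonneg (act u (simple_root i))"
  shows "reduced_up J I p (insert s I) q \<longleftrightarrow> nonneg (act u (simple_root s))"
proof -
  define v where "v = coset_max p"
  define x where "x = coset_min p"
  have sub: "J \<subseteq> S" "I \<subseteq> S" "insert s I \<subseteq> S" "s \<in> S" using fin by (auto simp: finitary_def)
  note pv = coset_max_characterization(1,2)[OF p fin(1,2), folded v_def]
  note px = coset_min_characterization(1,2)[OF p sub(1,2), folded x_def]
  have vc: "v \<in> carrier W" and xc: "x \<in> carrier W" using extremalD(1) pv(2) px(2) by blast+
  have zc: "z \<in> carrier W" using parabolic_closed(2)[OF sub(2) z] .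
  have up: "u \<in> p" using double_coset_mult(2)[OF p sub(1,2) pv(1) z] by (simp add: u v_def)
  have uc: "u \<in> carrier W" using double_coset_closed[OF p sub(1,2) up] .
  obtain a where a: "a \<in> parabolic J" "u = a \<otimes> x"
    using coset_min_left_coset[OF p sub(1,2) up u_min] unfolding x_def by blast
  have ac: "a \<in> carrier W" using parabolic_closed(2)[OF sub(1) a(1)] .
  define g where "g = act x (simple_root s)"
  have g: "g \<in> roots" using xc sub(4) by (simp add: g_def)
  have ug: "act u (simple_root s) = act a g"
    using ac xc sub(4) by (simp add: g_def a(2) act_mult)
  show ?thesis
  proof
    assume red: "reduced_up J I p (insert s I) q"
    then have x_min: "extremal 1 J (insert s I) x"
      using coset_min_characterization(2)[OF q sub(1,3)] by (simp add: reduced_up_def x_def)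
    have "nonneg g" using extremalD(2)[OF x_min, of s] by (simp add: g_def)
    moreover have "\<not> support g \<subseteq> J"
    proof
      assume "support g \<subseteq> J"
      then obtain j where j: "j \<in> J" "x \<otimes> s = j \<otimes> x"
        using extremal_simple_conjugate[OF x_min _ sub(1,3), of s] unfolding g_def by auto
      have jc: "j \<in> carrier W" using j(1) sub(1) by blast
      have "j = x \<otimes> s \<otimes> inv x" using j(2) xc jc by (simp add: m_assoc)
      then have "j \<in> left_red J (insert s I) q"
        using j(1) red by (auto simp: left_red_def reduced_up_def x_def)
      then have "j \<in> left_red J I p" using red by (simp add: reduced_up_def)
      then obtain i where i: "i \<in> I" "j = x \<otimes> i \<otimes> inv x" by (auto simp: left_red_def x_def)
      have ic: "i \<in> carrier W" using i(1) sub(2) by blast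
      have "x \<otimes> s = x \<otimes> i" using j(2) xc ic by (simp add: i(2) m_assoc)
      then have "inv x \<otimes> (x \<otimes> s) = inv x \<otimes> (x \<otimes> i)" by simp
      then have "s = i" using xc ic sub(4) by simp
      then show False using i(1) s by blast
    qed
    ultimately obtain t where t: "t \<notin> J" "0 < g t" by (auto simp: order_less_le)
    then have "0 < act a g t"
      using parabolic_act_coordinate[OF sub(1) a(1) root_in_space[OF g]] by simp
    then show "nonneg (act u (simple_root s))"
      unfolding ug using root_nonneg[OF act_roots[OF g ac]] by blast
  next
    assume "nonneg (act u (simple_root s))"
    then have pos: "nonneg (act a g)" by (simp add: ug)
    have g_pos: "nonneg g"
    proof (rule ccontr)
      assume "\<not> nonneg g"
      then have neg: "nonneg (\<lambda>t. - g t)" using nonneg_uminus_root[OF g] by blast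
      have "g t = 0" if "t \<notin> J" for t
        using spec[OF neg, of t] spec[OF pos, of t] that
          parabolic_act_coordinate[OF sub(1) a(1) root_in_space[OF g]] by simp
      then have "support (\<lambda>t. - g t) \<subseteq> J" by auto
      then have "0 \<le> 1 * act (inv x) (\<lambda>t. - g t) s"
        using act_nonneg[of "inv x" "\<lambda>t. - g t" J 1 s] extremalD(3)[OF px(2)] neg
          root_uminus[OF g] xc by simp
      moreover have "act (inv x) (\<lambda>t. - g t) s = - 1"
        using xc sub(4) g by (simp add: act_uminus) (simp add: g_def)
      ultimately show False by simp
    qed
    then have "extremal 1 J (insert s I) x" using px(2) by (simp add: extremal_def g_def)
    then have qx: "coset_min q = x"
      using coset_min_characterization(3)[OF q sub(1,3)] px(1) pq by blast
    have no: "x \<otimes> s \<otimes> inv x \<noteq> j" if j: "j \<in> J" for j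
    proof
      assume "x \<otimes> s \<otimes> inv x = j"
      then have xs: "x \<otimes> s = j \<otimes> x" using xc sub(4) by (auto simp: m_assoc)
      have jS: "j \<in> S" using j sub(1) by blast
      have "(\<lambda>t. - g t) = act (x \<otimes> s) (simple_root s)"
        using act_mult_S_root[OF xc sub(4)] by (simp add: g_def)
      also have "\<dots> = simple_reflection j g"
        using xc jS sub(4) by (simp add: xs act_mult act_S g_def)
      finally have refl_g: "simple_reflection j g t = - g t" for t by (simp add: fun_eq_iff)
      have "g t = 0" if "t \<notin> J" for t
        using refl_g[of t] simple_reflection_other[of t j g] that j by auto
      then have "support g \<subseteq> J" by auto
      then have "support (act a g) \<subseteq> J"
        using parabolic_act_support[OF sub(1) a(1)] g by blast
      then have "0 \<le> - 1 * act (inv v) (act a g) s"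
        using act_nonneg[of "inv v" "act a g" J "- 1" s] extremalD(3)[OF pv(2)] vc ac g pos by blast
      moreover have "act (inv v) (act a g) = act z (simple_root s)"
        unfolding ug[symmetric] using vc zc sub(4) by (simp add: u v_def[symmetric] act_mult)
      moreover have "act z (simple_root s) s = 1"
        using parabolic_act_coordinate[OF sub(2) z simple_root_in[OF sub(4)] s] by simp
      ultimately show False by simp
    qed
    then have "left_red J I p = left_red J (insert s I) q"
      unfolding left_red_def qx x_def[symmetric] by blast
    with qx show "reduced_up J I p (insert s I) q" by (simp add: reduced_up_def x_def)
  qed
qed

text \<open>
  A root supported in \<open>I \<union> {s}\<close> but not in \<open>I\<close> has the sign of its coordinate at \<open>s\<close>, which elements of
  \<open>W\<^sub>I\<close> do not change. So \<open>v = u z\<^sup>-\<^sup>1\<close> preserves the signs of all these roots if and only if \<open>u\<close> does,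
  and \<open>u\<close> is nonnegative on the simple roots in \<open>I\<close>.
\<close>

lemma ascent_iff_signs:
  assumes v: "v \<in> carrier W" and I: "insert s I \<subseteq> S" and s: "s \<notin> I"
    and z: "z \<in> parabolic I" and u: "u = v \<otimes> z"
    and u_min: "\<And>i. i \<in> I \<Longrightarrow> nonneg (act u (simple_root i))"
  shows "nonneg (act u (simple_root s)) \<longleftrightarrow>
    (\<forall>\<gamma>\<in>roots. support \<gamma> \<subseteq> insert s I \<longrightarrow> \<not> support \<gamma> \<subseteq> I \<longrightarrow> nonneg (act v \<gamma>) = nonneg \<gamma>)"
proof
  have sub: "I \<subseteq> S" "s \<in> S" using I by auto
  have zI': "z \<in> parabolic (insert s I)" using z parabolic_mono[of I "insert s I"] by blast
  have zc: "z \<in> carrier W" using parabolic_closed(2)[OF sub(1) z] .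
  have uc: "u \<in> carrier W" using u v zc by simp
  {
    assume us: "nonneg (act u (simple_root s))"
    have keep: "nonneg (act v \<gamma>)"
      if \<gamma>: "\<gamma> \<in> roots" "support \<gamma> \<subseteq> insert s I" "\<not> support \<gamma> \<subseteq> I" "nonneg \<gamma>" for \<gamma>
    proof -
      define \<delta> where "\<delta> = act (inv z) \<gamma>"
      have \<delta>: "\<delta> \<in> roots" using \<gamma>(1) zc by (simp add: \<delta>_def)
      have "\<gamma> s \<noteq> 0" using \<gamma>(2,3) by auto
      then have "\<gamma> s > 0" using spec[OF \<gamma>(4), of s] by simp
      then have "\<delta> s > 0"
        using parabolic_act_coordinate[OF sub(1) parabolic_closed(3)[OF sub(1) z] root_in_space[OF \<gamma>(1)] s]
        by (simp add: \<delta>_def)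
      then have "nonneg \<delta>" by (rule root_nonneg[OF \<delta>])
      moreover have "support \<delta> \<subseteq> insert s I"
        unfolding \<delta>_def
        by (rule parabolic_act_support[OF I parabolic_closed(3)[OF I zI'] root_in_space[OF \<gamma>(1)] \<gamma>(2)])
      moreover have "0 \<le> 1 * act u (simple_root i) t" if "i \<in> insert s I" for i t
        using that us u_min by auto
      ultimately have "0 \<le> 1 * act u \<delta> t" for t
        using act_nonneg[OF uc root_in_space[OF \<delta>], of "insert s I" 1 t] by blast
      moreover have "act u \<delta> = act v \<gamma>" using v zc \<gamma>(1) by (simp add: u \<delta>_def act_mult)
      ultimately show ?thesis by simp
    qed
    show "\<forall>\<gamma>\<in>roots. support \<gamma> \<subseteq> insert s I \<longrightarrow> \<not> support \<gamma> \<subseteq> I \<longrightarrow> nonneg (act v \<gamma>) = nonneg \<gamma>"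
    proof (intro ballI impI)
      fix \<gamma> assume \<gamma>: "\<gamma> \<in> roots" "support \<gamma> \<subseteq> insert s I" "\<not> support \<gamma> \<subseteq> I"
      show "nonneg (act v \<gamma>) = nonneg \<gamma>"
      proof (cases "nonneg \<gamma>")
        case True
        with keep[OF \<gamma>] show ?thesis by blast
      next
        case False
        have "support (\<lambda>t. - \<gamma> t) = support \<gamma>" by simp
        with False \<gamma> have "nonneg (\<lambda>t. - act v \<gamma> t)"
          using keep[OF root_uminus[OF \<gamma>(1)]] nonneg_uminus_root[OF \<gamma>(1)]
            act_uminus[OF v root_in_space[OF \<gamma>(1)]] by simp
        with False show ?thesis using nonneg_uminus_root[OF act_roots[OF \<gamma>(1) v]] by blast
      qed
    qed
  next
    assume cond: "\<forall>\<gamma>\<in>roots. support \<gamma> \<subseteq> insert s I \<longrightarrow> \<not> support \<gamma> \<subseteq> I \<longrightarrow> nonneg (act v \<gamma>) = nonneg \<gamma>"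
    define \<gamma> where "\<gamma> = act z (simple_root s)"
    have \<gamma>: "\<gamma> \<in> roots" using zc sub(2) by (simp add: \<gamma>_def)
    have \<gamma>s: "\<gamma> s = 1"
      using parabolic_act_coordinate[OF sub(1) z simple_root_in[OF sub(2)] s] by (simp add: \<gamma>_def)
    have "support \<gamma> \<subseteq> insert s I"
      unfolding \<gamma>_def using parabolic_act_support[OF I zI' simple_root_in[OF sub(2)]]
      by (simp add: support_simple_root)
    moreover have "\<not> support \<gamma> \<subseteq> I" using \<gamma>s s subsetD[of "support \<gamma>" I s] by auto
    moreover have "nonneg \<gamma>" using root_nonneg[OF \<gamma>, of s] \<gamma>s by simp
    ultimately have "nonneg (act v \<gamma>)" using cond \<gamma> by blast
    moreover have "act v \<gamma> = act u (simple_root s)" using v zc sub(2) by (simp add: u \<gamma>_def act_mult)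
    ultimately show "nonneg (act u (simple_root s))" by simp
  }
qed

theorem reduced_iff_half_space:
  assumes p: "p \<in> double_cosets J I" and q: "q \<in> double_cosets J (insert s I)" and pq: "p \<subseteq> q"
    and fin: "finitary J" "finitary I" "finitary (insert s I)" and s: "s \<notin> I"
  shows "reduced_up J I p (insert s I) q \<longleftrightarrow>
      (\<forall>b\<in>roots. facet (insert s I) q \<subseteq> hyperplane b \<longrightarrow> \<not> facet I p \<subseteq> half_plus b)"
    and "reduced_down q p \<longleftrightarrow>
      (\<forall>b\<in>roots. facet (insert s I) q \<subseteq> hyperplane b \<longrightarrow> \<not> facet I p \<subseteq> half_minus b)"
proof -
  have sub: "I \<subseteq> S" "insert s I \<subseteq> S" using fin by (auto simp: finitary_def)
  let ?v = "coset_max p"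
  have v: "?v \<in> carrier W"
    using extremalD(1)[OF coset_max_characterization(2)[OF p fin(1,2)]] .
  obtain y where y: "y \<in> parabolic (insert s I)" "coset_max q = ?v \<otimes> y"
    using coset_max_right_coset[OF p q pq fin] .
  obtain z where z: "z \<in> parabolic I" "\<And>i. i \<in> I \<Longrightarrow> nonneg (act (?v \<otimes> z) (simple_root i))"
    using right_coset_min[OF v sub(1)] by blast
  show "reduced_up J I p (insert s I) q \<longleftrightarrow>
      (\<forall>b\<in>roots. facet (insert s I) q \<subseteq> hyperplane b \<longrightarrow> \<not> facet I p \<subseteq> half_plus b)"
    unfolding facet_def root_sign_condition(1)[OF v y(2,1) sub(2), of I]
    by (rule HOL.trans[OF reduced_up_iff_ascent[OF p q pq fin s z(1) HOL.refl z(2)]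
        ascent_iff_signs[OF v sub(2) s z(1) HOL.refl z(2)]])
  show "reduced_down q p \<longleftrightarrow>
      (\<forall>b\<in>roots. facet (insert s I) q \<subseteq> hyperplane b \<longrightarrow> \<not> facet I p \<subseteq> half_minus b)"
    unfolding facet_def root_sign_condition(2)[OF v y(2,1) sub(2), of I]
    by (rule reduced_down_iff_signs[OF p q pq fin s])
qed

end

theorem proposition8p11:
  fixes W :: "('a, 'b) monoid_scheme" and S I I' J p q :: "'a set" and s :: 'a
  assumes "coxeter_system W S"
    and "coxeter_system.finitary W S J"
    and "coxeter_system.finitary W S I"
    and "s \<in> S - I"
    and "I' = insert s I"
    and "coxeter_system.finitary W S I'"
    and "p \<in> coxeter_system.double_cosets W J I"
    and "q \<in> coxeter_system.double_cosets W J I'"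
    and "p \<subseteq> q"
  shows "(coxeter_system.reduced_up W S J I p I' q \<longleftrightarrow>
      (\<forall>b \<in> coxeter_system.roots W S.
        coxeter_system.facet W S I' q \<subseteq> coxeter_system.hyperplane S b \<longrightarrow>
        \<not> coxeter_system.facet W S I p \<subseteq> coxeter_system.half_plus S b)) \<and>
    (coxeter_system.reduced_down W S q p \<longleftrightarrow>
      (\<forall>b \<in> coxeter_system.roots W S.
        coxeter_system.facet W S I' q \<subseteq> coxeter_system.hyperplane S b \<longrightarrow>
        \<not> coxeter_system.facet W S I p \<subseteq> coxeter_system.half_minus S b))"
proof -
  interpret coxeter_system W S by fact
  have "s \<notin> I" using assms(4) by blast
  with assms(2,3,6-9) show ?thesis
    unfolding assms(5) by (intro conjI reduced_iff_half_space)
qed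

end
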